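(* Let $r\ge0$ and let $A\in A^r$, i.e. $A$ is an $A_\varepsilon$-type set whose base angles satisfy $\lim_{n\to\infty}\theta_n=r$. Then the Hausdorff dimension of $A$ is $$\dim A=-\frac{\ln 2}{\ln\!\left(\frac12\,(1+(\tan r)^2)^{1/2}\right)} .$$
   Context: A triangular cap on a segment is a closed solid isosceles triangle having that segment as base; its base angle is either of its two equal angles. $A_\varepsilon$-type sets: let $A_{0,1}\subset\mathbb{R}^2$ be a segment of finite positive length, and $T_{0,1}$ a triangular cap on it of height $\varepsilon\mathcal{H}^1(A_{0,1})$ with $0<\varepsilon<1/100$ and base angle $\theta_0$. Let $\theta_0\ge\theta_1\ge\theta_2\ge\cdots$ be positive angles. Inductively, given caps $T_{n,i}$ on segments $A_{n,i}$, all with base angle $\theta_n$ ($1\le i\le2^n$), let $A_{n+1,2i-1},A_{n+1,2i}$ be the two edges of $T_{n,i}$ other than its base, and for $k\in\{2i-1,2i\}$ let $T_{n+1,k}\subset T_{n,i}$ be the triangular cap on $A_{n+1,k}$ with base angle $\theta_{n+1}$. Let $B=\bigcap_{n=0}^\infty\bigcup_{i=1}^{2^n}T_{n,i}$ and let $E(B)$ be the set of all vertices of all $T_{n,i}$. An $A_\varepsilon$-type set is any set $A\in\{B,B\setminus E(B)\}$ arising in this way. *)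

theory Defs
  imports "HOL-Analysis.Analysis"
begin

section \<open>Hausdorff measure and Hausdorff dimension\<close>

text \<open>
  The convention for exponent 0 is that nonempty sets contribute 1, so that the 0-dimensional
  measure is the counting measure (note that \<open>0 powr 0 = 0\<close> in Isabelle).  There is no
  normalising constant; in particular the 1-dimensional measure of a segment is its length.
\<close>

definition diam_power :: "real \<Rightarrow> 'a::metric_space set \<Rightarrow> ennreal" where
  "diam_power s U = (if U = {} then 0 else if s = 0 then 1 else ennreal (diameter U powr s))"

text \<open>
  Finite covers are included since the covering sets may be empty.  Boundedness is required
  explicitly because \<open>diameter\<close> is not meaningful on unbounded sets.
\<close>

definition hausdorff_pre_measure :: "real \<Rightarrow> real \<Rightarrow> 'a::metric_space set \<Rightarrow> ennreal" where
  "hausdorff_pre_measure s \<delta> A =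
     (INF U \<in> {U :: nat \<Rightarrow> 'a set. (\<forall>j. bounded (U j) \<and> diameter (U j) \<le> \<delta>) \<and> A \<subseteq> (\<Union>j. U j)}.
        (\<Sum>j. diam_power s (U j)))"

definition hausdorff_measure :: "real \<Rightarrow> 'a::metric_space set \<Rightarrow> ennreal" where
  "hausdorff_measure s A = (SUP \<delta> \<in> {0<..}. hausdorff_pre_measure s \<delta> A)"

definition hausdorff_dim :: "'a::metric_space set \<Rightarrow> ereal" where
  "hausdorff_dim A = Inf {ereal s | s. 0 \<le> s \<and> hausdorff_measure s A = 0}"


section \<open>Triangular caps\<close>

definition vec_angle :: "'a::real_inner \<Rightarrow> 'a \<Rightarrow> real" where
  "vec_angle u v = arccos ((u \<bullet> v) / (norm u * norm v))"

text \<open>The closed solid triangle with base \<open>[a,b]\<close> and apex \<open>c\<close>.\<close>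

definition triangle :: "real^2 \<Rightarrow> real^2 \<Rightarrow> real^2 \<Rightarrow> (real^2) set" where
  "triangle a b c = convex hull {a, b, c}"

definition triangular_cap :: "real^2 \<Rightarrow> real^2 \<Rightarrow> real^2 \<Rightarrow> real \<Rightarrow> bool" where
  "triangular_cap a b c \<theta> \<longleftrightarrow>
     \<not> collinear {a, b, c} \<and> dist a c = dist b c \<and> vec_angle (b - a) (c - a) = \<theta>"

definition cap_height :: "real^2 \<Rightarrow> real^2 \<Rightarrow> real^2 \<Rightarrow> real" where
  "cap_height a b c = infdist c (affine hull {a, b})"


section \<open>Sets of \<open>A_\<epsilon>\<close>-type\<close>

text \<open>
  The base segment \<open>A_{n,i}\<close> is \<open>closed_segment (a n i) (b n i)\<close> and the cap \<open>T_{n,i}\<close> is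
  \<open>triangle (a n i) (b n i) (c n i)\<close>; only the indices \<open>1 \<le> i \<le> 2^n\<close> are relevant.  The two
  legs of a cap become the two base segments below it in either order (the two segments on the
  right-hand side of the set equation are distinct), and their endpoints may be listed in
  either order.
\<close>

definition cap_system ::
  "real \<Rightarrow> (nat \<Rightarrow> real) \<Rightarrow> (nat \<Rightarrow> nat \<Rightarrow> real^2) \<Rightarrow> (nat \<Rightarrow> nat \<Rightarrow> real^2) \<Rightarrow> (nat \<Rightarrow> nat \<Rightarrow> real^2) \<Rightarrow> bool"
where
  "cap_system \<epsilon> \<theta> a b c \<longleftrightarrow>
     0 < \<epsilon> \<and> \<epsilon> < 1 / 100 \<and>
     (\<forall>n. 0 < \<theta> n) \<and> (\<forall>n. \<theta> (Suc n) \<le> \<theta> n) \<and>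
     a 0 1 \<noteq> b 0 1 \<and>
     ennreal (cap_height (a 0 1) (b 0 1) (c 0 1)) =
       ennreal \<epsilon> * hausdorff_measure 1 (closed_segment (a 0 1) (b 0 1)) \<and>
     (\<forall>n. \<forall>i\<in>{1..2^n}. triangular_cap (a n i) (b n i) (c n i) (\<theta> n)) \<and>
     (\<forall>n. \<forall>i\<in>{1..2^n}.
        {closed_segment (a (Suc n) (2*i-1)) (b (Suc n) (2*i-1)),
         closed_segment (a (Suc n) (2*i)) (b (Suc n) (2*i))} =
        {closed_segment (a n i) (c n i), closed_segment (c n i) (b n i)} \<and>
        (\<forall>k\<in>{2*i-1, 2*i}.
           triangle (a (Suc n) k) (b (Suc n) k) (c (Suc n) k) \<subseteq> triangle (a n i) (b n i) (c n i)))"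

definition cap_limit_set ::
  "(nat \<Rightarrow> nat \<Rightarrow> real^2) \<Rightarrow> (nat \<Rightarrow> nat \<Rightarrow> real^2) \<Rightarrow> (nat \<Rightarrow> nat \<Rightarrow> real^2) \<Rightarrow> (real^2) set"
where
  "cap_limit_set a b c = (\<Inter>n. \<Union>i\<in>{1..2^n}. triangle (a n i) (b n i) (c n i))"

definition cap_vertices ::
  "(nat \<Rightarrow> nat \<Rightarrow> real^2) \<Rightarrow> (nat \<Rightarrow> nat \<Rightarrow> real^2) \<Rightarrow> (nat \<Rightarrow> nat \<Rightarrow> real^2) \<Rightarrow> (real^2) set"
where
  "cap_vertices a b c = (\<Union>n. \<Union>i\<in>{1..2^n}. {a n i, b n i, c n i})"

definition A_eps_type_with_angles :: "(nat \<Rightarrow> real) \<Rightarrow> (real^2) set \<Rightarrow> bool" where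
  "A_eps_type_with_angles \<theta> A \<longleftrightarrow>
     (\<exists>\<epsilon> a b c. cap_system \<epsilon> \<theta> a b c \<and>
        A \<in> {cap_limit_set a b c, cap_limit_set a b c - cap_vertices a b c})"

text \<open>The class \<open>A^r\<close>.\<close>

definition A_class :: "real \<Rightarrow> (real^2) set set" where
  "A_class r = {A. \<exists>\<theta>. A_eps_type_with_angles \<theta> A \<and> \<theta> \<longlonglongrightarrow> r}"

end

theory Submission
  imports Defs
begin

text \<open>
  All level-\<open>n\<close> bases have the same length \<open>L n\<close>, and \<open>L (Suc n) = L n / (2 cos \<theta>\<^sub>n)\<close>.  Let \<open>\<rho> = 1 / (2 cos r)\<close> and
  let \<open>s\<close> be determined by \<open>\<rho> powr s = 1/2\<close>.  Since \<open>L (Suc n) / L n \<longlonglongrightarrow> \<rho>\<close>, covering by the \<open>2^n\<close> triangles of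
  level \<open>n\<close> makes the \<open>t\<close>-dimensional measure vanish for every \<open>t > s\<close>.

  For the lower bound, the assumption \<open>\<epsilon> < 1/100\<close> makes all triangles so flat that the two subtriangles of
  a triangle leave their common vertex in nearly opposite directions; hence a set of diameter less
  than \<open>L m / 4\<close> meets at most two triangles of level \<open>m\<close>.  Parametrise the limit set by \<open>{0<..1}\<close>, sending
  the \<open>i\<close>-th dyadic interval of level \<open>m\<close> into the \<open>i\<close>-th triangle.  As the angles decrease to \<open>r\<close>,
  \<open>L m \<ge> L 0 * \<rho>^m\<close>, so the preimage of a set of diameter \<open>d\<close> has Lebesgue measure at most a constant
  times \<open>d powr s\<close>.  Points have null preimages, so deleting the countably many vertices is harmless.
\<close>

section \<open>Flat triangles\<close>

lemma midpoint_conv_diff: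
  fixes a b :: "'a::real_normed_vector"
  shows "midpoint a b = a + (1/2) *\<^sub>R (b - a)" "midpoint a b = b - (1/2) *\<^sub>R (b - a)"
  unfolding midpoint_def by (simp_all add: algebra_simps flip: scaleR_add_left)

text \<open>For an isosceles triangle the distance from apex to base midpoint is the height, so this
  is the bound \<open>\<epsilon> < 1/100\<close> in a form free of angles and symmetric in
  \<open>a\<close> and \<open>b\<close>.\<close>

definition flat_tri :: "'a::euclidean_space \<Rightarrow> 'a \<Rightarrow> 'a \<Rightarrow> bool" where
  "flat_tri a b c \<longleftrightarrow> norm (c - midpoint a b) \<le> dist a b / 100"

lemma flat_tri_commute: "flat_tri a b c \<longleftrightarrow> flat_tri b a c"
  by (simp add: flat_tri_def midpoint_sym dist_commute)

text \<open>Coordinates centred at the apex: \<open>h\<close> is half the base vector and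
  \<open>w\<close> the small displacement of the apex from the base midpoint.\<close>

lemma flat_triE:
  assumes "flat_tri a b c"
  obtains h w where "a = c - h - w" "b = c + h - w" "norm w \<le> norm h / 50" "dist a b = 2 * norm h"
proof
  define h where "h = (1/2) *\<^sub>R (b - a)"
  define w where "w = c - midpoint a b"
  have e: "midpoint a b = a + h" "midpoint a b = b - h"
    unfolding h_def by (fact midpoint_conv_diff)+
  show "a = c - h - w" "b = c + h - w"
    unfolding w_def using e by (simp_all add: algebra_simps)
  show d: "dist a b = 2 * norm h"
    by (simp add: h_def dist_norm norm_minus_commute)
  show "norm w \<le> norm h / 50"
    using assms d by (simp add: flat_tri_def w_def)
qed

text \<open>The main term is at most \<open>- norm h ^ 2 / 4\<close>, while the error terms
  contribute at most \<open>(1/400 + 1/20 + 1/20) * norm h ^ 2\<close>.\<close>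

lemma inner_near_opposite_nonpos:
  fixes h :: "'a::euclidean_space"
  assumes "norm (x + \<alpha> *\<^sub>R h) \<le> norm h / 20" "norm (y - \<beta> *\<^sub>R h) \<le> norm h / 20"
    "1/2 \<le> \<alpha>" "\<alpha> \<le> 1" "1/2 \<le> \<beta>" "\<beta> \<le> 1"
  shows "x \<bullet> y \<le> 0"
proof -
  define e where "e = x + \<alpha> *\<^sub>R h"
  define f where "f = y - \<beta> *\<^sub>R h"
  let ?H = "norm h"
  have "x \<bullet> y = (e - \<alpha> *\<^sub>R h) \<bullet> (f + \<beta> *\<^sub>R h)"
    by (simp add: e_def f_def)
  also have "\<dots> = e \<bullet> f + \<beta> * (e \<bullet> h) - \<alpha> * (h \<bullet> f) - \<alpha> * \<beta> * (?H * ?H)"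
    by (simp add: algebra_simps inner_commute flip: dot_square_norm power2_eq_square)
  also have "\<dots> \<le> ?H/20 * (?H/20) + 1 * (?H/20 * ?H) + 1 * (?H * (?H/20)) - 1/4 * (?H * ?H)"
  proof -
    have 1: "e \<bullet> f \<le> ?H/20 * (?H/20)"
      using norm_cauchy_schwarz[of e f] mult_mono[of "norm e" "?H/20" "norm f" "?H/20"] assms
      by (simp add: e_def f_def)
    have 2: "\<bar>e \<bullet> h\<bar> \<le> ?H/20 * ?H"
      using Cauchy_Schwarz_ineq2[of e h] mult_right_mono[of "norm e" "?H/20" "?H"] assms
      by (simp add: e_def)
    have 3: "\<bar>h \<bullet> f\<bar> \<le> ?H * (?H/20)"
      using Cauchy_Schwarz_ineq2[of h f] mult_left_mono[of "norm f" "?H/20" "?H"] assms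
      by (simp add: f_def)
    have 4: "\<beta> * (e \<bullet> h) \<le> 1 * (?H/20 * ?H)"
    proof -
      have "\<beta> * (e \<bullet> h) \<le> \<bar>\<beta>\<bar> * \<bar>e \<bullet> h\<bar>" by (simp flip: abs_mult)
      also have "\<dots> \<le> 1 * (?H/20 * ?H)" using assms 2 by (intro mult_mono) auto
      finally show ?thesis .
    qed
    have 5: "- (\<alpha> * (h \<bullet> f)) \<le> 1 * (?H * (?H/20))"
    proof -
      have "- (\<alpha> * (h \<bullet> f)) \<le> \<bar>\<alpha>\<bar> * \<bar>h \<bullet> f\<bar>" by (simp flip: abs_mult)
      also have "\<dots> \<le> 1 * (?H * (?H/20))" using assms 3 by (intro mult_mono) auto
      finally show ?thesis .
    qed
    have "1/2 * (1/2) \<le> \<alpha> * \<beta>" using assms by (intro mult_mono) auto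
    then have 6: "1/4 * (?H * ?H) \<le> \<alpha> * \<beta> * (?H * ?H)"
      by (intro mult_right_mono) auto
    show ?thesis using 1 4 5 6 by linarith
  qed
  also have "\<dots> \<le> 0" by (simp add: field_simps)
  finally show ?thesis .
qed

text \<open>A triangle lies in the cone spanned at a vertex by its two edges, so signs of inner
  products need only be checked on edge vectors.\<close>

lemma convex_hull_3_offset:
  assumes "x \<in> convex hull {p, q, z}"
  obtains s t where "s \<ge> 0" "t \<ge> 0" "x - q = s *\<^sub>R (p - q) + t *\<^sub>R (z - q)"
proof -
  obtain u v w where *: "0 \<le> u" "0 \<le> v" "0 \<le> w" "u + v + w = 1"
      "x = u *\<^sub>R p + v *\<^sub>R q + w *\<^sub>R z"
    using assms unfolding convex_hull_3 by auto
  have "x - q = x - (u + v + w) *\<^sub>R q" using *(4) by simp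
  also have "\<dots> = u *\<^sub>R (p - q) + w *\<^sub>R (z - q)"
    unfolding *(5) by (simp add: algebra_simps)
  finally have "x - q = u *\<^sub>R (p - q) + w *\<^sub>R (z - q)" .
  then show ?thesis using * that by blast
qed

text \<open>The new base \<open>[c, b]\<close> has midpoint \<open>c + (h - w)/2\<close>, and
  \<open>c'\<close> lies within a hundredth of the length of \<open>[c, b]\<close> from it; both
  errors together stay below \<open>norm h / 20\<close>.\<close>

lemma flat_tri_child_apex:
  fixes a b c :: "'a::euclidean_space"
  assumes "b = c + h - w" "norm w \<le> norm h / 50" "flat_tri c b c'"
  shows "norm (c' - c - (1/2) *\<^sub>R h) \<le> norm h / 20"
proof -
  define e where "e = c' - midpoint c b"
  have "dist c b = norm (h - w)" unfolding assms(1) by (simp add: dist_norm norm_minus_commute)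
  also have "\<dots> \<le> norm h + norm w" by (rule norm_triangle_ineq4)
  finally have e: "norm e \<le> (norm h + norm w) / 100"
    using assms(3) by (simp add: flat_tri_def e_def)
  have "c' - c - (1/2) *\<^sub>R h = e - (1/2) *\<^sub>R w"
    unfolding e_def midpoint_def assms(1) by (simp add: algebra_simps flip: scaleR_add_left)
  then have "norm (c' - c - (1/2) *\<^sub>R h) \<le> norm e + norm ((1/2) *\<^sub>R w)"
    by (metis norm_triangle_ineq4)
  also have "\<dots> = norm e + norm w / 2" by simp
  also have "\<dots> \<le> norm h / 20" using e assms(2) norm_ge_zero[of h] by argo
  finally show ?thesis .
qed

text \<open>Seen from \<open>c\<close>, the edges of one child point roughly along \<open>-h\<close>
  and those of the other along \<open>h\<close>. Inner products across the two cones are therefore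
  nonpositive, the angle at \<open>c\<close> in the triangle \<open>x c y\<close> is not acute, and
  the side \<open>x y\<close> is the longest.\<close>

lemma flat_tri_separation:
  fixes a b c :: "'a::euclidean_space"
  assumes "flat_tri a b c" "flat_tri a c c1" "flat_tri c b c2"
    "x \<in> convex hull {a, c, c1}" "y \<in> convex hull {c, b, c2}"
  shows "dist x c \<le> dist x y" "dist y c \<le> dist x y"
proof -
  obtain h w where hw: "a = c - h - w" "b = c + h - w" "norm w \<le> norm h / 50"
    using assms(1) by (rule flat_triE)
  have b1: "norm ((a - c) + 1 *\<^sub>R h) \<le> norm h / 20"
    using hw norm_ge_zero[of h] by (simp del: norm_ge_zero)
  have b2: "norm ((b - c) - 1 *\<^sub>R h) \<le> norm h / 20"
    using hw norm_ge_zero[of h] by (simp del: norm_ge_zero)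
  have b3: "norm ((c2 - c) - (1/2) *\<^sub>R h) \<le> norm h / 20"
    using flat_tri_child_apex[OF hw(2,3) assms(3)] .
  \<comment> \<open>Exchanging \<open>a\<close> and \<open>b\<close> reverses \<open>h\<close>, so
    the child over \<open>[a, c]\<close> is treated with \<open>-h\<close>.\<close>
  have b4: "norm ((c1 - c) + (1/2) *\<^sub>R h) \<le> norm h / 20"
    using flat_tri_child_apex[of a c "-h" w c1] hw assms(2) by (simp add: flat_tri_commute)
  obtain s t where st: "s \<ge> 0" "t \<ge> 0" "x - c = s *\<^sub>R (a - c) + t *\<^sub>R (c1 - c)"
    using convex_hull_3_offset[OF assms(4)] .
  obtain s' t' where st': "s' \<ge> 0" "t' \<ge> 0" "y - c = s' *\<^sub>R (b - c) + t' *\<^sub>R (c2 - c)"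
    using convex_hull_3_offset[of y b c c2] assms(5) by (auto simp: insert_commute)
  note n = inner_near_opposite_nonpos
  have i: "(a - c) \<bullet> (b - c) \<le> 0" "(a - c) \<bullet> (c2 - c) \<le> 0"
          "(c1 - c) \<bullet> (b - c) \<le> 0" "(c1 - c) \<bullet> (c2 - c) \<le> 0"
    by (rule n[OF b1 b2] n[OF b1 b3] n[OF b4 b2] n[OF b4 b3]; simp)+
  have "(x - c) \<bullet> (y - c) = s * s' * ((a - c) \<bullet> (b - c)) + s * t' * ((a - c) \<bullet> (c2 - c))
      + t * s' * ((c1 - c) \<bullet> (b - c)) + t * t' * ((c1 - c) \<bullet> (c2 - c))"
    unfolding st(3) st'(3) by (simp only: inner_add_left inner_add_right inner_scaleR_left inner_scaleR_right) (simp add: algebra_simps)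
  also have "\<dots> \<le> 0"
    using st(1,2) st'(1,2) i by (intro add_nonpos_nonpos mult_nonneg_nonpos) auto
  finally have le: "(x - c) \<bullet> (y - c) \<le> 0" .
  have "(norm (x - y))\<^sup>2 = (norm ((x - c) - (y - c)))\<^sup>2" by simp
  also have "\<dots> = (norm (x - c))\<^sup>2 + (norm (y - c))\<^sup>2 - 2 * ((x - c) \<bullet> (y - c))"
    by (simp only: power2_norm_eq_inner inner_diff_left inner_diff_right) (simp add: inner_commute)
  finally have eq: "(norm (x - y))\<^sup>2 = (norm (x - c))\<^sup>2 + (norm (y - c))\<^sup>2 - 2 * ((x - c) \<bullet> (y - c))" .
  have "(norm (x - c))\<^sup>2 \<le> (norm (x - y))\<^sup>2" using eq le zero_le_power2[of "norm (y - c)"] by linarith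
  then show "dist x c \<le> dist x y" by (simp add: dist_norm)
  have "(norm (y - c))\<^sup>2 \<le> (norm (x - y))\<^sup>2" using eq le zero_le_power2[of "norm (x - c)"] by linarith
  then show "dist y c \<le> dist x y" by (simp add: dist_norm)
qed

text \<open>Projected to the direction \<open>h\<close>, the vertices \<open>c\<close>,
  \<open>b\<close>, \<open>c2\<close> lie ahead of \<open>a\<close> by about \<open>norm h\<close>,
  \<open>2 * norm h\<close> and \<open>3/2 * norm h\<close>. The half-space \<open>?S\<close>, at
  distance \<open>norm h / 2\<close> from \<open>a\<close>, leaves room for the errors and contains
  the whole child by convexity.\<close>

lemma flat_tri_far_endpoint:
  fixes a b c :: "'a::euclidean_space"
  assumes "flat_tri a b c" "flat_tri c b c2" "y \<in> convex hull {c, b, c2}"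
  shows "dist a b / 4 \<le> dist a y"
proof -
  obtain h w where hw: "a = c - h - w" "b = c + h - w" "norm w \<le> norm h / 50" "dist a b = 2 * norm h"
    using assms(1) by (rule flat_triE)
  let ?S = "{y. h \<bullet> y \<ge> h \<bullet> a + (norm h)\<^sup>2 / 2}"
  have hz: "h \<bullet> z \<ge> - ((norm h)\<^sup>2 / 20)" if "norm z \<le> norm h / 20" for z
  proof -
    have "\<bar>h \<bullet> z\<bar> \<le> norm h * norm z" by (rule Cauchy_Schwarz_ineq2)
    also have "\<dots> \<le> norm h * (norm h / 20)" using that by (intro mult_left_mono) auto
    finally show ?thesis by (simp add: power2_eq_square)
  qed
  have w: "h \<bullet> w \<ge> - ((norm h)\<^sup>2 / 20)" using hw(3) norm_ge_zero[of h] by (intro hz) linarith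
  have e: "h \<bullet> (c2 - c - (1/2) *\<^sub>R h) \<ge> - ((norm h)\<^sup>2 / 20)"
    by (rule hz[OF flat_tri_child_apex[OF hw(2,3) assms(2)]])
  have hh: "h \<bullet> h = (norm h)\<^sup>2" by (simp add: power2_norm_eq_inner)
  have "h \<bullet> c \<ge> h \<bullet> a + (norm h)\<^sup>2 / 2" "h \<bullet> b \<ge> h \<bullet> a + (norm h)\<^sup>2 / 2"
    using w zero_le_power2[of "norm h"] unfolding hw(1,2) inner_diff_right inner_add_right hh by linarith+
  moreover have "h \<bullet> c2 \<ge> h \<bullet> a + (norm h)\<^sup>2 / 2"
    using w e zero_le_power2[of "norm h"]
    unfolding hw(1) inner_diff_right inner_add_right inner_scaleR_right hh by linarith
  ultimately have "{c, b, c2} \<subseteq> ?S" by simp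
  moreover have "convex ?S" by (rule convex_halfspace_ge)
  ultimately have "y \<in> ?S" using assms(3) hull_minimal[of "{c,b,c2}" ?S convex] by auto
  then have "(norm h)\<^sup>2 / 2 \<le> h \<bullet> (y - a)" by (simp add: inner_diff_right)
  also have "\<dots> \<le> norm h * norm (y - a)" by (rule norm_cauchy_schwarz)
  finally have "norm h * (norm h / 2) \<le> norm h * norm (y - a)" by (simp add: power2_eq_square)
  then have "norm h / 2 \<le> norm (y - a)" by (cases "h = 0") (auto simp: mult_le_cancel_left)
  then show ?thesis using hw(4) by (simp add: dist_norm norm_minus_commute)
qed

lemma flat_tri_cong:
  assumes "{a, b} = {a', b'}"
  shows "flat_tri a b c \<longleftrightarrow> flat_tri a' b' c"
  using assms by (auto simp: doubleton_eq_iff flat_tri_commute)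

text \<open>The diameter of a simplex is attained at two vertices, and flatness makes both legs at
  most as long as the base.\<close>

lemma diameter_flat_tri:
  fixes a b c :: "'a::euclidean_space"
  assumes "flat_tri a b c"
  shows "diameter (convex hull {a, b, c}) \<le> dist a b"
proof -
  obtain h w where hw: "a = c - h - w" "b = c + h - w" "norm w \<le> norm h / 50" "dist a b = 2 * norm h"
    using assms by (rule flat_triE)
  have "norm (h + w) \<le> 2 * norm h" "norm (h - w) \<le> 2 * norm h"
    using norm_triangle_ineq[of h w] norm_triangle_ineq4[of h w] hw(3) norm_ge_zero[of h] by linarith+
  moreover have "a - c = - (h + w)" "b - c = h - w"
    unfolding hw(1,2) by simp_all
  ultimately have *: "norm (a - c) \<le> dist a b" "norm (b - c) \<le> dist a b"
    unfolding hw(4) by (simp_all only: norm_minus_cancel)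
  obtain u v where "u \<in> {a,b,c}" "v \<in> {a,b,c}"
    and uv: "\<And>x y. x \<in> convex hull {a,b,c} \<Longrightarrow> y \<in> convex hull {a,b,c} \<Longrightarrow> norm (x - y) \<le> norm (u - v)"
    using simplex_extremal_le[of "{a,b,c}"] by blast
  then have "norm (u - v) \<le> dist a b"
    using * by (auto simp: norm_minus_commute dist_norm)
  with uv have "\<And>x y. x \<in> convex hull {a,b,c} \<Longrightarrow> y \<in> convex hull {a,b,c} \<Longrightarrow> norm (x - y) \<le> dist a b"
    by (meson order_trans)
  then show ?thesis by (intro diameter_le) auto
qed

section \<open>Trees of flat triangles\<close>

text \<open>The indices of the triangles \<open>d\<close> levels below the triangle with index \<open>i\<close>.\<close>

definition descendants :: "nat \<Rightarrow> nat \<Rightarrow> nat set" where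
  "descendants i d = {2^d * (i - 1)<..2^d * i}"

lemma descendants_0: "1 \<le> i \<Longrightarrow> descendants i 0 = {i}"
  by (auto simp: descendants_def)

lemma descendants_Suc:
  assumes "1 \<le> i"
  shows "descendants i (Suc d) = descendants (2*i - 1) d \<union> descendants (2*i) d"
proof -
  obtain j where j: "i = Suc j" using assms by (cases i) auto
  show ?thesis unfolding descendants_def j by (auto simp: algebra_simps)
qed

lemma descendants_1: "descendants (Suc 0) d = {1..2^d}"
  by (auto simp: descendants_def)

lemma child_index: "i \<in> {1..2^n} \<Longrightarrow> k \<in> {2*i-1, 2*i} \<Longrightarrow> k \<in> {1..2^Suc n}" for i n k :: nat
  by auto

lemma children_index:
  fixes i n k1 k2 :: nat
  assumes "i \<in> {1..2^n}" "{k1, k2} = {2*i-1, 2*i}"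
  shows "k1 \<in> {1..2^Suc n}" "k2 \<in> {1..2^Suc n}"
proof -
  have "k1 \<in> {2*i-1, 2*i}" "k2 \<in> {2*i-1, 2*i}" unfolding assms(2)[symmetric] by simp_all
  then show "k1 \<in> {1..2^Suc n}" "k2 \<in> {1..2^Suc n}" by (blast intro: child_index[OF assms(1)])+
qed

section \<open>Dyadic subdivision of the unit interval\<close>

definition dyadic_index :: "nat \<Rightarrow> real \<Rightarrow> nat" where
  "dyadic_index m \<tau> = nat \<lceil>2^m * \<tau>\<rceil>"

text \<open>Open on the left to match the ceiling in \<open>dyadic_index\<close>. Both fit the
  numbering of triangles from 1, which is why parameters range over \<open>{0<..1}\<close>.\<close>

definition dyadic_interval :: "nat \<Rightarrow> nat \<Rightarrow> real set" where
  "dyadic_interval m k = {(real k - 1) / 2^m <.. real k / 2^m}"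

lemma dyadic_index_bounds:
  assumes "0 < \<tau>"
  shows "real (dyadic_index m \<tau>) - 1 < 2^m * \<tau>" "2^m * \<tau> \<le> real (dyadic_index m \<tau>)"
proof -
  have "0 < 2^m * \<tau>" using assms by simp
  then have "real (dyadic_index m \<tau>) = of_int \<lceil>2^m * \<tau>\<rceil>"
    unfolding dyadic_index_def by (simp add: of_nat_nat)
  then show "real (dyadic_index m \<tau>) - 1 < 2^m * \<tau>" "2^m * \<tau> \<le> real (dyadic_index m \<tau>)"
    by linarith+
qed

lemma dyadic_index_range:
  assumes "0 < \<tau>" "\<tau> \<le> 1"
  shows "dyadic_index m \<tau> \<in> {1..2^m}"
proof -
  have "2^m * \<tau> \<le> 2^m" "0 < 2^m * \<tau>" using assms by simp_all
  then have "real (dyadic_index m \<tau>) < 2^m + 1" "0 < real (dyadic_index m \<tau>)"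
    using dyadic_index_bounds[OF assms(1), of m] by linarith+
  then have "real (dyadic_index m \<tau>) < real (2^m + 1)" "real 0 < real (dyadic_index m \<tau>)" by simp_all
  then have "dyadic_index m \<tau> < 2^m + 1" "0 < dyadic_index m \<tau>" by (simp_all only: of_nat_less_iff)
  then show ?thesis by simp
qed

lemma dyadic_index_interval: "0 < \<tau> \<Longrightarrow> \<tau> \<in> dyadic_interval m (dyadic_index m \<tau>)"
  using dyadic_index_bounds[of \<tau> m] by (simp add: dyadic_interval_def field_simps)

lemma dyadic_index_Suc:
  assumes "0 < \<tau>"
  shows "dyadic_index (Suc m) \<tau> \<in> {2 * dyadic_index m \<tau> - 1, 2 * dyadic_index m \<tau>}"
proof -
  let ?i = "dyadic_index m \<tau>" and ?j = "dyadic_index (Suc m) \<tau>"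
  have "real ?j < real (2 * ?i + 1)" "real (2 * ?i) < real (?j + 2)"
    using dyadic_index_bounds[OF assms, of m] dyadic_index_bounds[OF assms, of "Suc m"] by auto
  then have "?j < 2 * ?i + 1" "2 * ?i < ?j + 2" by (simp_all only: of_nat_less_iff)
  then show ?thesis by auto
qed

lemma emeasure_dyadic_interval: "emeasure lborel (dyadic_interval m k) = ennreal ((1/2)^m)"
  by (simp add: dyadic_interval_def emeasure_lborel_Ioc divide_right_mono power_one_over
      flip: diff_divide_distrib)

text \<open>What the dimension argument uses of a cap system, with angles replaced by the base
  lengths \<open>L n\<close>. The children are given as unordered pairs of unordered endpoint pairs,
  since neither the order of the two legs nor that of their endpoints is prescribed.\<close>

locale flat_tree =
  fixes a b c :: "nat \<Rightarrow> nat \<Rightarrow> 'a::euclidean_space" and L :: "nat \<Rightarrow> real"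
  assumes base: "\<And>n i. i \<in> {1..2^n} \<Longrightarrow> dist (a n i) (b n i) = L n"
    and flat: "\<And>n i. i \<in> {1..2^n} \<Longrightarrow> flat_tri (a n i) (b n i) (c n i)"
    and children: "\<And>n i. i \<in> {1..2^n} \<Longrightarrow>
      {{a (Suc n) (2*i-1), b (Suc n) (2*i-1)}, {a (Suc n) (2*i), b (Suc n) (2*i)}} =
      {{a n i, c n i}, {c n i, b n i}}"
    and nested: "\<And>n i k. i \<in> {1..2^n} \<Longrightarrow> k \<in> {2*i-1, 2*i} \<Longrightarrow>
      convex hull {a (Suc n) k, b (Suc n) k, c (Suc n) k} \<subseteq> convex hull {a n i, b n i, c n i}"
    and L_pos: "\<And>n. 0 < L n"
    and L_Suc: "\<And>n. L (Suc n) \<le> 51/100 * L n"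
begin

abbreviation T :: "nat \<Rightarrow> nat \<Rightarrow> 'a set" where
  "T n i \<equiv> convex hull {a n i, b n i, c n i}"

definition limit_set :: "'a set" where
  "limit_set = (\<Inter>n. \<Union>i\<in>{1..2^n}. T n i)"

lemma L_antimono: "m \<le> n \<Longrightarrow> L n \<le> L m"
proof (rule lift_Suc_antimono_le)
  show "L (Suc n) \<le> L n" for n using L_Suc[of n] L_pos[of n] by simp
qed

lemma L_geometric: "L n \<le> (51/100)^n * L 0"
proof (induction n)
  case (Suc n)
  have "L (Suc n) \<le> 51/100 * L n" by (rule L_Suc)
  also have "\<dots> \<le> 51/100 * ((51/100)^n * L 0)" using Suc by simp
  finally show ?case by simp
qed simp

lemma L_tendsto_0: "L \<longlonglongrightarrow> 0"
proof (rule tendsto_sandwich[OF _ _ tendsto_const])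
  show "(\<lambda>n. (51/100)^n * L 0) \<longlonglongrightarrow> 0"
    by (intro tendsto_mult_left_zero LIMSEQ_realpow_zero) auto
qed (use L_geometric L_pos in \<open>auto intro: less_imp_le always_eventually\<close>)

lemma diameter_T: "i \<in> {1..2^n} \<Longrightarrow> diameter (T n i) \<le> L n"
  using diameter_flat_tri[OF flat] base by metis

lemma descendants_nested: "i \<in> {1..2^n} \<Longrightarrow> k \<in> descendants i d \<Longrightarrow> T (n + d) k \<subseteq> T n i"
proof (induction d arbitrary: n i)
  case 0
  then show ?case by (simp add: descendants_0)
next
  case (Suc d)
  then obtain j where j: "j \<in> {2*i-1, 2*i}" "k \<in> descendants j d"
    using descendants_Suc[of i d] by auto
  then have "T (Suc n + d) k \<subseteq> T (Suc n) j"
    using Suc.prems by (intro Suc.IH child_index) auto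
  also have "\<dots> \<subseteq> T n i" using nested Suc.prems j by blast
  finally show ?case by simp
qed

text \<open>Fixes names for the two children, \<open>k1\<close> over the leg at \<open>a\<close> and
  \<open>k2\<close> over the leg at \<open>b\<close>, whichever of the two indices each of them
  carries.\<close>

lemma children_split:
  assumes "i \<in> {1..2^n}"
  obtains k1 k2 where "{k1, k2} = {2*i-1, 2*i}"
    "{a (Suc n) k1, b (Suc n) k1} = {a n i, c n i}" "{a (Suc n) k2, b (Suc n) k2} = {c n i, b n i}"
proof -
  consider "{a (Suc n) (2*i-1), b (Suc n) (2*i-1)} = {a n i, c n i}" "{a (Suc n) (2*i), b (Suc n) (2*i)} = {c n i, b n i}"
    | "{a (Suc n) (2*i), b (Suc n) (2*i)} = {a n i, c n i}" "{a (Suc n) (2*i-1), b (Suc n) (2*i-1)} = {c n i, b n i}"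
    using children[OF assms]
    by (subst (asm) doubleton_eq_iff) blast
  then show ?thesis
    by cases (use that[of "2*i-1" "2*i"] that[of "2*i" "2*i-1"] in \<open>simp_all add: insert_commute\<close>)
qed

lemma child_triangle:
  assumes "{a n k, b n k} = {p, q}"
  shows "T n k = convex hull {p, q, c n k}"
proof -
  have "{a n k, b n k, c n k} = {a n k, b n k} \<union> {c n k}" by auto
  also have "\<dots> = {p, q, c n k}" unfolding assms by auto
  finally show ?thesis by simp
qed

lemma children_separated:
  assumes i: "i \<in> {1..2^n}"
  obtains k1 k2 where "{k1, k2} = {2*i-1, 2*i}"
    "c n i \<in> {a (Suc n) k1, b (Suc n) k1}" "c n i \<in> {a (Suc n) k2, b (Suc n) k2}"
    "\<And>x y. x \<in> T (Suc n) k1 \<Longrightarrow> y \<in> T (Suc n) k2 \<Longrightarrow> dist (c n i) x \<le> dist x y \<and> dist (c n i) y \<le> dist x y"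
proof -
  obtain k1 k2 where k: "{k1, k2} = {2*i-1, 2*i}"
    and k1: "{a (Suc n) k1, b (Suc n) k1} = {a n i, c n i}"
    and k2: "{a (Suc n) k2, b (Suc n) k2} = {c n i, b n i}"
    using children_split[OF i] .
  have r: "k1 \<in> {1..2^Suc n}" "k2 \<in> {1..2^Suc n}"
    using children_index[OF i k] by auto
  have f: "flat_tri (a n i) (c n i) (c (Suc n) k1)" "flat_tri (c n i) (b n i) (c (Suc n) k2)"
    using flat[OF r(1)] flat[OF r(2)] flat_tri_cong[OF k1] flat_tri_cong[OF k2] by auto
  show ?thesis
  proof (rule that[OF k])
    show "c n i \<in> {a (Suc n) k1, b (Suc n) k1}" "c n i \<in> {a (Suc n) k2, b (Suc n) k2}"
      unfolding k1 k2 by auto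
    show "dist (c n i) x \<le> dist x y \<and> dist (c n i) y \<le> dist x y"
      if "x \<in> T (Suc n) k1" "y \<in> T (Suc n) k2" for x y
      using flat_tri_separation[OF flat[OF i] f, of x y] that
      unfolding child_triangle[OF k1] child_triangle[OF k2] by (simp add: dist_commute)
  qed
qed

text \<open>An endpoint of the base is inherited by the child over the adjacent leg; the other child
  stays away from it by \<open>flat_tri_far_endpoint\<close>. The case of \<open>b\<close> follows
  by reflection.\<close>

lemma child_far_from_endpoint:
  assumes i: "i \<in> {1..2^n}" and p: "p \<in> {a n i, b n i}"
  obtains k1 k2 where "{k1, k2} = {2*i-1, 2*i}" "p \<in> {a (Suc n) k1, b (Suc n) k1}"
    "\<And>y. y \<in> T (Suc n) k2 \<Longrightarrow> L n / 4 \<le> dist p y"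
proof -
  obtain k1 k2 where k: "{k1, k2} = {2*i-1, 2*i}"
    and k1: "{a (Suc n) k1, b (Suc n) k1} = {a n i, c n i}"
    and k2: "{a (Suc n) k2, b (Suc n) k2} = {c n i, b n i}"
    using children_split[OF i] .
  have r: "k1 \<in> {1..2^Suc n}" "k2 \<in> {1..2^Suc n}"
    using children_index[OF i k] by auto
  have f: "flat_tri (a n i) (c n i) (c (Suc n) k1)" "flat_tri (c n i) (b n i) (c (Suc n) k2)"
    using flat[OF r(1)] flat[OF r(2)] flat_tri_cong[OF k1] flat_tri_cong[OF k2] by auto
  from p consider "p = a n i" | "p = b n i" by auto
  then show ?thesis
  proof cases
    case 1
    show ?thesis
    proof (rule that[OF k])
      show "p \<in> {a (Suc n) k1, b (Suc n) k1}" unfolding k1 using 1 by simp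
      show "L n / 4 \<le> dist p y" if "y \<in> T (Suc n) k2" for y
        using flat_tri_far_endpoint[OF flat[OF i] f(2), of y] that
        unfolding child_triangle[OF k2] base[OF i] 1 by simp
    qed
  next
    case 2
    have f': "flat_tri (b n i) (a n i) (c n i)" "flat_tri (c n i) (a n i) (c (Suc n) k1)"
      using flat[OF i] f(1) by (simp_all add: flat_tri_commute)
    show ?thesis
    proof (rule that[of k2 k1])
      show "{k2, k1} = {2*i-1, 2*i}" using k by (simp add: insert_commute)
      show "p \<in> {a (Suc n) k2, b (Suc n) k2}" unfolding k2 using 2 by simp
      show "L n / 4 \<le> dist p y" if "y \<in> T (Suc n) k1" for y
        using flat_tri_far_endpoint[OF f', of y] that base[OF i]
        unfolding child_triangle[OF k1] 2 by (simp add: dist_commute insert_commute)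
    qed
  qed
qed

section \<open>Counting the triangles of one level that meet a small set\<close>

definition hit :: "'a set \<Rightarrow> nat \<Rightarrow> nat \<Rightarrow> nat \<Rightarrow> nat set" where
  "hit U n i d = {k \<in> descendants i d. T (n + d) k \<inter> U \<noteq> {}}"

lemma finite_hit [simp]: "finite (hit U n i d)"
  by (simp add: hit_def descendants_def)

lemma card_hit_0: "1 \<le> i \<Longrightarrow> card (hit U n i 0) \<le> 1"
  using card_mono[of "{i}" "hit U n i 0"] by (simp add: hit_def descendants_0 subset_iff)

lemma hit_Suc:
  assumes "1 \<le> i" "{k1, k2} = {2*i-1, 2*i}"
  shows "hit U n i (Suc d) = hit U (Suc n) k1 d \<union> hit U (Suc n) k2 d"
proof -
  have "descendants i (Suc d) = descendants k1 d \<union> descendants k2 d"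
    using assms by (auto simp: descendants_Suc doubleton_eq_iff)
  then show ?thesis by (auto simp: hit_def)
qed

lemma hit_empty: "i \<in> {1..2^n} \<Longrightarrow> T n i \<inter> U = {} \<Longrightarrow> hit U n i d = {}"
  using descendants_nested by (force simp: hit_def)

text \<open>At each level the child not containing \<open>p\<close> is too far away to be met, so
  the triangles met form a single descending path that keeps \<open>p\<close> as a base
  endpoint.\<close>

lemma card_hit_near_endpoint:
  "i \<in> {1..2^n} \<Longrightarrow> p \<in> {a n i, b n i} \<Longrightarrow> (\<And>u. u \<in> U \<Longrightarrow> dist p u < L (n + d) / 4) \<Longrightarrow>
    card (hit U n i d) \<le> 1"
proof (induction d arbitrary: n i)
  case 0
  then show ?case by (intro card_hit_0) auto
next
  case (Suc d)
  obtain k1 k2 where k: "{k1, k2} = {2*i-1, 2*i}" "p \<in> {a (Suc n) k1, b (Suc n) k1}"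
    "\<And>y. y \<in> T (Suc n) k2 \<Longrightarrow> L n / 4 \<le> dist p y"
    using child_far_from_endpoint[OF Suc.prems(1,2)] by metis
  have r: "k1 \<in> {1..2^Suc n}" "k2 \<in> {1..2^Suc n}"
    using children_index[OF Suc.prems(1) k(1)] by auto
  \<comment> \<open>The radius is measured at the final level, hence lies below the separation
    \<open>L n / 4\<close> at every level above it.\<close>
  have "L (n + Suc d) \<le> L n" by (intro L_antimono) simp
  then have "T (Suc n) k2 \<inter> U = {}"
    using k(3) Suc.prems(3) by fastforce
  then have "hit U n i (Suc d) = hit U (Suc n) k1 d"
    using hit_Suc[OF _ k(1)] hit_empty[OF r(2)] Suc.prems(1) by simp
  moreover have "card (hit U (Suc n) k1 d) \<le> 1"
    using Suc.prems(3) by (intro Suc.IH[OF r(1) k(2)]) simp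
  ultimately show ?case by simp
qed

text \<open>
  If \<open>U\<close> meets both children, the separation at the apex \<open>c n i\<close> forces all of \<open>U\<close> to be close to that
  common endpoint, and each child contributes at most one triangle.
\<close>

lemma card_hit_small_set:
  "i \<in> {1..2^n} \<Longrightarrow> (\<And>u v. u \<in> U \<Longrightarrow> v \<in> U \<Longrightarrow> dist u v < L (n + d) / 4) \<Longrightarrow>
    card (hit U n i d) \<le> 2"
proof (induction d arbitrary: n i)
  case 0
  then show ?case using card_hit_0[of i U n] by auto
next
  case (Suc d)
  obtain k1 k2 where k: "{k1, k2} = {2*i-1, 2*i}"
    "c n i \<in> {a (Suc n) k1, b (Suc n) k1}" "c n i \<in> {a (Suc n) k2, b (Suc n) k2}"
    and sep: "\<And>x y. x \<in> T (Suc n) k1 \<Longrightarrow> y \<in> T (Suc n) k2 \<Longrightarrow> dist (c n i) x \<le> dist x y \<and> dist (c n i) y \<le> dist x y"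
    using children_separated[OF Suc.prems(1)] by metis
  have r: "k1 \<in> {1..2^Suc n}" "k2 \<in> {1..2^Suc n}"
    using children_index[OF Suc.prems(1) k(1)] by auto
  have IH: "card (hit U (Suc n) k1 d) \<le> 2" "card (hit U (Suc n) k2 d) \<le> 2"
    using Suc.prems(2) by (intro Suc.IH r; simp)+
  note hS = hit_Suc[OF _ k(1), of U n d]
  consider "T (Suc n) k1 \<inter> U = {}" | "T (Suc n) k2 \<inter> U = {}"
    | x y where "x \<in> T (Suc n) k1" "x \<in> U" "y \<in> T (Suc n) k2" "y \<in> U" by blast
  then show ?case
  proof cases
    case 1
    then show ?thesis using hS hit_empty[OF r(1) 1, of d] IH Suc.prems(1) by simp
  next
    case 2
    then show ?thesis using hS hit_empty[OF r(2) 2, of d] IH Suc.prems(1) by simp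
  next
    case 3
    \<comment> \<open>Only the part of \<open>U\<close> inside a child is known to be near the apex.
      Descendants lie inside the child, so they meet no other part.\<close>
    have "hit U (Suc n) k d = hit (U \<inter> T (Suc n) k) (Suc n) k d" if "k \<in> {1..2^Suc n}" for k
      using descendants_nested[OF that] by (force simp: hit_def)
    note restrict = this[OF r(1)] this[OF r(2)]
    have "card (hit (U \<inter> T (Suc n) k1) (Suc n) k1 d) \<le> 1"
    proof (rule card_hit_near_endpoint[OF r(1) k(2)])
      fix u assume "u \<in> U \<inter> T (Suc n) k1"
      then show "dist (c n i) u < L (Suc n + d) / 4"
        using sep[of u y] Suc.prems(2)[of u y] 3 by auto
    qed
    moreover have "card (hit (U \<inter> T (Suc n) k2) (Suc n) k2 d) \<le> 1"
    proof (rule card_hit_near_endpoint[OF r(2) k(3)])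
      fix u assume "u \<in> U \<inter> T (Suc n) k2"
      then show "dist (c n i) u < L (Suc n + d) / 4"
        using sep[of x u] Suc.prems(2)[of x u] 3 by auto
    qed
    ultimately show ?thesis
      using hS card_Un_le[of "hit U (Suc n) k1 d" "hit U (Suc n) k2 d"] restrict Suc.prems(1) by simp
  qed
qed

section \<open>Parametrisation of the limit set and measure of preimages\<close>

lemma limit_point_exists:
  assumes "0 < \<tau>" "\<tau> \<le> 1"
  shows "\<exists>x. \<forall>m. x \<in> T m (dyadic_index m \<tau>)"
proof -
  have "T (Suc m) (dyadic_index (Suc m) \<tau>) \<subseteq> T m (dyadic_index m \<tau>)" for m
    using nested dyadic_index_range[OF assms, of m] dyadic_index_Suc[OF assms(1)] by blast
  then have "T n (dyadic_index n \<tau>) \<subseteq> T m (dyadic_index m \<tau>)" if "m \<le> n" for m n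
    using lift_Suc_antimono_le[of "\<lambda>m. T m (dyadic_index m \<tau>)"] that by blast
  then have "(\<Inter>m. T m (dyadic_index m \<tau>)) \<noteq> {}"
    by (intro compact_nest finite_imp_compact_convex_hull) auto
  then show ?thesis by auto
qed

definition limit_point :: "real \<Rightarrow> 'a" where
  "limit_point \<tau> = (SOME x. \<forall>m. x \<in> T m (dyadic_index m \<tau>))"

lemma limit_point_mem: "0 < \<tau> \<Longrightarrow> \<tau> \<le> 1 \<Longrightarrow> limit_point \<tau> \<in> T m (dyadic_index m \<tau>)"
  using someI_ex[OF limit_point_exists] unfolding limit_point_def by blast

lemma limit_point_limit_set: "0 < \<tau> \<Longrightarrow> \<tau> \<le> 1 \<Longrightarrow> limit_point \<tau> \<in> limit_set"
  using limit_point_mem dyadic_index_range unfolding limit_set_def by blast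

text \<open>At most two triangles of level \<open>m\<close> meet \<open>U\<close>, so the preimage
  lies in two dyadic intervals of length \<open>(1/2)^m\<close>. The preimage itself is not shown to
  be measurable, hence the Borel superset \<open>M\<close>.\<close>

lemma preimage_cover:
  assumes "bounded U" "diameter U < L m / 4"
  shows "\<exists>M\<in>sets lborel. {\<tau>\<in>{0<..1}. limit_point \<tau> \<in> U} \<subseteq> M \<and> emeasure lborel M \<le> ennreal (2 * (1/2)^m)"
proof
  \<comment> \<open>Index 1 at level 0 is the root, so this ranges over all triangles of level
    \<open>m\<close>.\<close>
  let ?H = "hit U 0 1 m"
  let ?M = "\<Union>k\<in>?H. dyadic_interval m k"
  show "?M \<in> sets lborel"
    by (auto simp: dyadic_interval_def intro!: sets.finite_UN)
  have "card ?H \<le> 2"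
  proof (rule card_hit_small_set)
    show "dist u v < L (0 + m) / 4" if "u \<in> U" "v \<in> U" for u v
      using le_less_trans[OF diameter_bounded_bound[OF assms(1) that] assms(2)] by simp
  qed simp
  have "emeasure lborel ?M \<le> (\<Sum>k\<in>?H. emeasure lborel (dyadic_interval m k))"
    by (intro emeasure_subadditive_finite) (auto simp: dyadic_interval_def)
  also have "\<dots> = of_nat (card ?H) * ennreal ((1/2)^m)"
    by (simp add: emeasure_dyadic_interval)
  also have "\<dots> \<le> of_nat 2 * ennreal ((1/2)^m)"
    using \<open>card ?H \<le> 2\<close> by (intro mult_right_mono) (auto simp del: of_nat_numeral)
  also have "\<dots> = ennreal (2 * (1/2)^m)"
    by (simp add: ennreal_mult)
  finally have "emeasure lborel ?M \<le> ennreal (2 * (1/2)^m)" .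
  moreover have "{\<tau>\<in>{0<..1}. limit_point \<tau> \<in> U} \<subseteq> ?M"
  proof
    fix \<tau> assume *: "\<tau> \<in> {\<tau>\<in>{0<..1}. limit_point \<tau> \<in> U}"
    then have "dyadic_index m \<tau> \<in> ?H"
      using limit_point_mem[of \<tau> m] dyadic_index_range[of \<tau> m] by (auto simp: hit_def descendants_1)
    then show "\<tau> \<in> ?M" using dyadic_index_interval[of \<tau> m] * by auto
  qed
  ultimately show "{\<tau>\<in>{0<..1}. limit_point \<tau> \<in> U} \<subseteq> ?M \<and> emeasure lborel ?M \<le> ennreal (2 * (1/2)^m)"
    by blast
qed

text \<open>Diameter 0 is below \<open>L m / 4\<close> for every \<open>m\<close>, so the covers for
  all levels can be intersected. This serves both degenerate covering sets and the countably many
  deleted points.\<close>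

lemma preimage_cover_null:
  assumes "bounded U" "diameter U = 0"
  shows "\<exists>M\<in>null_sets lborel. {\<tau>\<in>{0<..1}. limit_point \<tau> \<in> U} \<subseteq> M"
proof -
  have "\<exists>M\<in>sets lborel. {\<tau>\<in>{0<..1}. limit_point \<tau> \<in> U} \<subseteq> M \<and> emeasure lborel M \<le> ennreal (2 * (1/2)^m)" for m
    using assms L_pos by (intro preimage_cover) auto
  then have "\<forall>m. \<exists>M. M \<in> sets lborel \<and> {\<tau>\<in>{0<..1}. limit_point \<tau> \<in> U} \<subseteq> M \<and> emeasure lborel M \<le> ennreal (2 * (1/2)^m)"
    by blast
  from choice[OF this] obtain M where M: "\<And>m. M m \<in> sets lborel" "\<And>m. {\<tau>\<in>{0<..1}. limit_point \<tau> \<in> U} \<subseteq> M m"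
      "\<And>m. emeasure lborel (M m) \<le> ennreal (2 * (1/2)^m)"
    by blast
  let ?I = "\<Inter>m. M m"
  have I: "?I \<in> sets lborel" using M(1) by (intro sets.countable_INT) auto
  have "emeasure lborel ?I \<le> ennreal (2 * (1/2)^m)" for m
    using M(1,3) I order_trans[OF emeasure_mono[of ?I "M m" lborel]] by blast
  moreover have "(\<lambda>m. ennreal (2 * (1/2)^m)) \<longlonglongrightarrow> ennreal 0"
    by (intro tendsto_ennrealI tendsto_mult_right_zero LIMSEQ_realpow_zero) auto
  ultimately have "emeasure lborel ?I \<le> ennreal 0"
    by (intro LIMSEQ_le_const[of _ "ennreal 0"]) blast+
  then have "?I \<in> null_sets lborel" using I by (auto simp: null_sets_def)
  then show ?thesis using M(2) by blast
qed

text \<open>The estimate for the mass distribution principle: \<open>L m\<close> is matched to the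
  diameter of \<open>U\<close>, and \<open>K\<close> converts the dyadic mass \<open>(1/2)^m\<close>
  into a power of length.\<close>

lemma preimage_cover_powr:
  assumes "bounded U" "diameter U < L 0 / 4" "0 < s"
    and K: "\<And>m. (1/2)^m \<le> K * L m powr s"
  shows "\<exists>M\<in>sets lborel. {\<tau>\<in>{0<..1}. limit_point \<tau> \<in> U} \<subseteq> M \<and>
    emeasure lborel M \<le> ennreal (4 * K * 4 powr s * diameter U powr s)"
proof (cases "diameter U = 0")
  case True
  then obtain M where "M \<in> null_sets lborel" "{\<tau>\<in>{0<..1}. limit_point \<tau> \<in> U} \<subseteq> M"
    using preimage_cover_null[OF assms(1)] by blast
  then show ?thesis using null_setsD1[of M lborel] null_setsD2[of M lborel]
    by (intro bexI[of _ M] conjI) simp_all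
next
  case False
  then have d: "0 < diameter U" using diameter_ge_0[OF assms(1)] by simp
  have "0 < K * L 0 powr s" using K[of 0] less_le_trans[OF zero_less_one] by simp
  then have K0: "0 < K" using L_pos[of 0] by (simp add: zero_less_mult_iff)
  have "\<exists>n. L n < 4 * diameter U"
    using eventually_happens'[OF _ order_tendstoD(2)[OF L_tendsto_0, of "4 * diameter U"]] d by simp
  then obtain n where n: "L n < 4 * diameter U" ..
  \<comment> \<open>Minimality gives both bounds: level \<open>m\<close> has \<open>L m\<close> at
    most \<open>4 * diameter U\<close>, while level \<open>m - 1\<close> is still coarse enough for
    \<open>preimage_cover\<close>. A predecessor exists because \<open>4 * diameter U < L 0\<close>.
    The shift by one level turns the factor 2 into 4.\<close>
  define m where "m = (LEAST m. L m \<le> 4 * diameter U)"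
  have m: "L m \<le> 4 * diameter U"
    unfolding m_def using LeastI[of "\<lambda>m. L m \<le> 4 * diameter U" n] n by simp
  have "m \<noteq> 0" using m assms(2) by (intro notI) simp
  then obtain j where j: "m = Suc j" by (cases m) auto
  have "\<not> L j \<le> 4 * diameter U"
    by (rule not_less_Least) (simp add: j flip: m_def)
  then obtain M where M: "M \<in> sets lborel" "{\<tau>\<in>{0<..1}. limit_point \<tau> \<in> U} \<subseteq> M"
      "emeasure lborel M \<le> ennreal (2 * (1/2)^j)"
    using preimage_cover[OF assms(1), of j] by auto
  have "2 * (1/2)^j = 4 * (1/2::real)^m" by (simp add: j)
  also have "\<dots> \<le> 4 * (K * (4 * diameter U) powr s)"
  proof -
    have "L m powr s \<le> (4 * diameter U) powr s"
      using m L_pos[of m] assms(3) by (intro powr_mono2) auto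
    then have "K * L m powr s \<le> K * (4 * diameter U) powr s" using K0 by simp
    then show ?thesis using K[of m] by simp
  qed
  also have "\<dots> = 4 * K * 4 powr s * diameter U powr s"
    using d by (simp add: powr_mult)
  finally have "ennreal (2 * (1/2)^j) \<le> ennreal (4 * K * 4 powr s * diameter U powr s)"
    by (rule ennreal_leI)
  then show ?thesis using M by (meson order_trans)
qed

text \<open>The preimages of the sets \<open>U j\<close>, together with the null preimage of
  \<open>E\<close>, exhaust \<open>{0<..1}\<close>, which has measure 1.\<close>

lemma cover_sum_lower_bound:
  assumes "countable E" "limit_set - E \<subseteq> (\<Union>j. U j)"
    and U: "\<And>j::nat. bounded (U j)" "\<And>j. diameter (U j) < L 0 / 4"
    and s: "0 < s" and K: "\<And>m. (1/2)^m \<le> K * L m powr s"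
  shows "1 \<le> (\<Sum>j. ennreal (4 * K * 4 powr s * diameter (U j) powr s))"
proof -
  have "\<exists>M\<in>sets lborel. {\<tau>\<in>{0<..1}. limit_point \<tau> \<in> U j} \<subseteq> M \<and>
    emeasure lborel M \<le> ennreal (4 * K * 4 powr s * diameter (U j) powr s)" for j
    by (rule preimage_cover_powr[OF U s K])
  then have "\<forall>j. \<exists>M. M \<in> sets lborel \<and> {\<tau>\<in>{0<..1}. limit_point \<tau> \<in> U j} \<subseteq> M \<and>
    emeasure lborel M \<le> ennreal (4 * K * 4 powr s * diameter (U j) powr s)"
    by blast
  from choice[OF this] obtain M where M: "\<And>j. M j \<in> sets lborel" "\<And>j. {\<tau>\<in>{0<..1}. limit_point \<tau> \<in> U j} \<subseteq> M j"
    "\<And>j. emeasure lborel (M j) \<le> ennreal (4 * K * 4 powr s * diameter (U j) powr s)"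
    by blast
  have "\<exists>N\<in>null_sets lborel. {\<tau>\<in>{0<..1}. limit_point \<tau> \<in> {e}} \<subseteq> N" for e
    by (rule preimage_cover_null) auto
  then obtain N where N: "\<And>e. N e \<in> null_sets lborel" "\<And>e. {\<tau>\<in>{0<..1}. limit_point \<tau> \<in> {e}} \<subseteq> N e"
    by metis
  let ?N = "\<Union>e\<in>E. N e"
  have N': "?N \<in> null_sets lborel" using N(1) assms(1) by (intro null_sets_UN') auto
  have sub: "{0<..1} \<subseteq> (\<Union>j. M j) \<union> ?N"
  proof
    fix \<tau> :: real assume \<tau>: "\<tau> \<in> {0<..1}"
    then have "limit_point \<tau> \<in> limit_set" by (simp add: limit_point_limit_set)
    then consider "limit_point \<tau> \<in> E" | j where "limit_point \<tau> \<in> U j" using assms(2) by blast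
    then show "\<tau> \<in> (\<Union>j. M j) \<union> ?N"
    proof cases
      case 1
      then show ?thesis using N(2)[of "limit_point \<tau>"] \<tau> by blast
    next
      case (2 j)
      then show ?thesis using M(2)[of j] \<tau> by blast
    qed
  qed
  have UM: "(\<Union>j. M j) \<in> sets lborel" using M(1) by auto
  have "1 = emeasure lborel {0<..1::real}" by simp
  also have "\<dots> \<le> emeasure lborel ((\<Union>j. M j) \<union> ?N)"
    using sub UM N' by (intro emeasure_mono) auto
  also have "\<dots> = emeasure lborel (\<Union>j. M j)"
    by (rule emeasure_Un_null_set[OF UM N'])
  also have "\<dots> \<le> (\<Sum>j. emeasure lborel (M j))"
    using M(1) by (intro emeasure_subadditive_countably) auto
  also have "\<dots> \<le> (\<Sum>j. ennreal (4 * K * 4 powr s * diameter (U j) powr s))"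
    using M(3) by (intro suminf_le) auto
  finally show ?thesis .
qed

end

section \<open>Hausdorff dimension of the limit set\<close>

text \<open>The finite cover is padded with empty sets, which contribute 0.\<close>

lemma hausdorff_pre_measure_finite_cover:
  fixes U :: "nat \<Rightarrow> 'a::metric_space set"
  assumes "A \<subseteq> (\<Union>j<n. U j)" "\<And>j. j < n \<Longrightarrow> bounded (U j)" "\<And>j. j < n \<Longrightarrow> diameter (U j) \<le> d"
    and "d \<le> \<delta>" "0 \<le> d" "0 < s"
  shows "hausdorff_pre_measure s \<delta> A \<le> ennreal (real n * d powr s)"
proof -
  define V where "V j = (if j < n then U j else {})" for j
  have "hausdorff_pre_measure s \<delta> A \<le> (\<Sum>j. diam_power s (V j))"
    unfolding hausdorff_pre_measure_def
  proof (rule INF_lower)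
    have "A \<subseteq> (\<Union>j. V j)" using assms(1) unfolding V_def by fastforce
    moreover have "bounded (V j) \<and> diameter (V j) \<le> \<delta>" for j
      using assms(2)[of j] assms(3)[of j] assms(4,5) by (auto simp: V_def)
    ultimately show "V \<in> {U. (\<forall>j. bounded (U j) \<and> diameter (U j) \<le> \<delta>) \<and> A \<subseteq> (\<Union>j. U j)}" by blast
  qed
  also have "\<dots> = (\<Sum>j<n. diam_power s (V j))"
    by (rule suminf_finite) (auto simp: V_def diam_power_def)
  also have "\<dots> \<le> (\<Sum>j<n. ennreal (d powr s))"
  proof (rule sum_mono)
    fix j assume "j \<in> {..<n}"
    then have "bounded (V j)" "diameter (V j) \<le> d" using assms(2,3) by (auto simp: V_def)
    then show "diam_power s (V j) \<le> ennreal (d powr s)"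
      using assms(6) diameter_ge_0 by (auto simp: diam_power_def intro!: ennreal_leI powr_mono2)
  qed
  also have "\<dots> = ennreal (real n * d powr s)"
    by (simp add: ennreal_mult ennreal_of_nat_eq_real_of_nat)
  finally show ?thesis .
qed

text \<open>The segment is cut into \<open>n\<close> equal pieces shorter than
  \<open>\<delta>\<close>. The bound turns the height condition of a cap system into one on the
  length of the base.\<close>

lemma hausdorff_measure_1_segment_le:
  fixes a b :: "'a::euclidean_space"
  shows "hausdorff_measure 1 (closed_segment a b) \<le> ennreal (dist a b)"
  unfolding hausdorff_measure_def
proof (rule SUP_least)
  fix \<delta> :: real assume \<delta>: "\<delta> \<in> {0<..}"
  obtain n where n: "dist a b / \<delta> < real n" "n > 0"
    by (metis reals_Archimedean2 gr0I of_nat_0 divide_nonneg_pos greaterThan_iff \<delta> not_less zero_le_dist)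
  define p where "p j = a + (real j / real n) *\<^sub>R (b - a)" for j
  have "closed_segment a b \<subseteq> (\<Union>j<n. closed_segment (p j) (p (Suc j)))"
  proof
    fix x assume "x \<in> closed_segment a b"
    then obtain u where u: "0 \<le> u" "u \<le> 1" "x = a + u *\<^sub>R (b - a)"
      by (auto simp: in_segment algebra_simps)
    obtain j where j: "j < n" "real j \<le> u * n" "u * n \<le> real j + 1"
    \<comment> \<open>The right endpoint belongs to the last piece \<open>n - 1\<close>, whereas the
      floor would give \<open>n\<close>.\<close>
    proof (cases "u = 1")
      case True
      then show ?thesis using n that[of "n - 1"] by auto
    next
      case False
      then have "u * n < n" using u n by simp
      then have "nat \<lfloor>u * n\<rfloor> < n" using u(1) by (subst nat_less_iff) (simp_all add: floor_less_iff)
      moreover have "0 \<le> u * n" using u by simp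
      ultimately show ?thesis using that[of "nat \<lfloor>u * n\<rfloor>"] by linarith
    qed
    have "x = (1 - (u * n - j)) *\<^sub>R p j + (u * n - j) *\<^sub>R p (Suc j)"
    proof -
      have "(1 - (u * n - j)) *\<^sub>R p j + (u * n - j) *\<^sub>R p (Suc j) =
          a + ((1 - (u * n - j)) * (real j / n) + (u * n - j) * (real (Suc j) / n)) *\<^sub>R (b - a)"
        unfolding p_def by (simp add: algebra_simps)
      also have "(1 - (u * n - j)) * (real j / n) + (u * n - j) * (real (Suc j) / n) = u"
        using n by (simp add: field_simps)
      finally show ?thesis using u by simp
    qed
    then have "x \<in> closed_segment (p j) (p (Suc j))"
      using j by (auto simp: in_segment intro!: exI[of _ "u * n - j"])
    then show "x \<in> (\<Union>j<n. closed_segment (p j) (p (Suc j)))" using j by blast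
  qed
  moreover have "diameter (closed_segment (p j) (p (Suc j))) \<le> dist a b / n" for j
  proof (rule diameter_le)
    fix x y assume "x \<in> closed_segment (p j) (p (Suc j))" "y \<in> closed_segment (p j) (p (Suc j))"
    then obtain u v where uv: "0 \<le> u" "u \<le> 1" "0 \<le> v" "v \<le> 1"
        and xy: "x = (1 - u) *\<^sub>R p j + u *\<^sub>R p (Suc j)" "y = (1 - v) *\<^sub>R p j + v *\<^sub>R p (Suc j)"
      unfolding in_segment by blast
    have "x - y = (v - u) *\<^sub>R (p j - p (Suc j))" unfolding xy by (simp add: algebra_simps)
    then have "norm (x - y) = \<bar>v - u\<bar> * norm (p j - p (Suc j))" by simp
    also have "\<dots> \<le> 1 * norm (p j - p (Suc j))" using uv by (intro mult_right_mono) auto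
    also have "1 * norm (p j - p (Suc j)) = norm (p j - p (Suc j))" by simp
    also have "p j - p (Suc j) = - ((1 / n) *\<^sub>R (b - a))"
      by (simp add: p_def algebra_simps add_divide_distrib)
    finally show "norm (x - y) \<le> dist a b / n" by (simp add: dist_norm norm_minus_commute)
  qed simp
  ultimately have "hausdorff_pre_measure 1 \<delta> (closed_segment a b) \<le> ennreal (real n * (dist a b / n) powr 1)"
    using n \<delta> by (intro hausdorff_pre_measure_finite_cover[where n = n and U = "\<lambda>j. closed_segment (p j) (p (Suc j))"])
      (auto simp: field_simps bounded_closed_segment)
  then show "hausdorff_pre_measure 1 \<delta> (closed_segment a b) \<le> ennreal (dist a b)"
    using n by simp
qed

context flat_tree
begin

lemma hausdorff_measure_0I:
  assumes "0 < s" "(\<lambda>n. 2^n * L n powr s) \<longlonglongrightarrow> 0" "A \<subseteq> limit_set"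
  shows "hausdorff_measure s A = 0"
proof -
  have "hausdorff_pre_measure s \<delta> A \<le> ennreal 0" if \<delta>: "0 < \<delta>" for \<delta>
  proof (rule tendsto_lowerbound)
    show "(\<lambda>n. ennreal (2^n * L n powr s)) \<longlonglongrightarrow> ennreal 0"
      by (intro tendsto_ennrealI assms)
    have le: "hausdorff_pre_measure s \<delta> A \<le> ennreal (2^n * L n powr s)" if n: "L n < \<delta>" for n
    proof -
      have "A \<subseteq> (\<Union>j<2^n. T n (Suc j))"
      proof
        fix x assume "x \<in> A"
        then obtain i where "i \<in> {1..2^n}" "x \<in> T n i" using assms(3) unfolding limit_set_def by blast
        \<comment> \<open>Triangles are numbered from 1, covering sets from 0.\<close>
        then show "x \<in> (\<Union>j<2^n. T n (Suc j))" by (intro UN_I[of "i - 1"]) auto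
      qed
      then have "hausdorff_pre_measure s \<delta> A \<le> ennreal (real (2^n) * L n powr s)"
        using diameter_T[of _ n] L_pos[of n] n assms(1)
        by (intro hausdorff_pre_measure_finite_cover[where U = "\<lambda>j. T n (Suc j)"])
          (auto intro!: compact_imp_bounded finite_imp_compact_convex_hull)
      then show ?thesis by simp
    qed
    show "\<forall>\<^sub>F n in sequentially. hausdorff_pre_measure s \<delta> A \<le> ennreal (2^n * L n powr s)"
      using order_tendstoD(2)[OF L_tendsto_0 \<delta>] by eventually_elim (rule le)
  qed simp
  then show ?thesis unfolding hausdorff_measure_def by (auto intro!: antisym SUP_least)
qed

text \<open>Every sufficiently fine cover has sum at least \<open>1 / ?K\<close>. All exponents up
  to \<open>s\<close> are handled together, because covering sets of diameter at most 1 have larger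
  \<open>t\<close>-powers than \<open>s\<close>-powers.\<close>

lemma hausdorff_measure_nonzeroI:
  assumes E: "countable E" "limit_set - E \<subseteq> A"
    and s: "0 < s" and K: "\<And>m. (1/2)^m \<le> K * L m powr s" and t: "0 \<le> t" "t \<le> s"
  shows "hausdorff_measure t A \<noteq> 0"
proof -
  let ?K = "4 * K * 4 powr s"
  \<comment> \<open>The bound 1 is for comparing exponents, \<open>L 0 / 8\<close> for the strict
    bound \<open>L 0 / 4\<close> in \<open>cover_sum_lower_bound\<close>.\<close>
  define \<delta> where "\<delta> = min 1 (L 0 / 8)"
  have \<delta>: "0 < \<delta>" "\<delta> \<le> 1" "\<delta> < L 0 / 4" using L_pos[of 0] by (auto simp: \<delta>_def)
  have "0 < K * L 0 powr s" using K[of 0] less_le_trans[OF zero_less_one] by simp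
  then have K0: "0 < ?K" using L_pos[of 0] by (simp add: zero_less_mult_iff)
  have "ennreal (1 / ?K) \<le> hausdorff_pre_measure t \<delta> A"
    unfolding hausdorff_pre_measure_def
  proof (rule INF_greatest)
    fix U :: "nat \<Rightarrow> 'a set"
    assume "U \<in> {U. (\<forall>j. bounded (U j) \<and> diameter (U j) \<le> \<delta>) \<and> A \<subseteq> (\<Union>j. U j)}"
    then have U: "\<And>j. bounded (U j)" "\<And>j. diameter (U j) \<le> \<delta>" "A \<subseteq> (\<Union>j. U j)" by auto
    have "1 \<le> (\<Sum>j. ennreal (?K * diameter (U j) powr s))"
      using U(1,3) E(2) le_less_trans[OF U(2) \<delta>(3)]
      by (intro cover_sum_lower_bound[OF E(1) _ _ _ s K]) auto
    also have "\<dots> = (\<Sum>j. ennreal ?K * ennreal (diameter (U j) powr s))"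
      using K0 by (simp add: ennreal_mult)
    also have "\<dots> = ennreal ?K * (\<Sum>j. ennreal (diameter (U j) powr s))" by simp
    finally have 1: "1 \<le> ennreal ?K * (\<Sum>j. ennreal (diameter (U j) powr s))" .
    have le: "ennreal (diameter (U j) powr s) \<le> diam_power t (U j)" for j
    proof (cases "U j = {}")
      case False
      have d: "0 \<le> diameter (U j)" "diameter (U j) \<le> 1"
        using diameter_ge_0[OF U(1)] order_trans[OF U(2) \<delta>(2)] by auto
      show ?thesis
      \<comment> \<open>Exponent 0 is separate because \<open>diam_power\<close> then counts a
        nonempty set as 1, even when its diameter is 0.\<close>
      proof (cases "t = 0")
        case True
        have "diameter (U j) powr s \<le> 1" using d s powr_le1[of s "diameter (U j)"] by simp
        then show ?thesis using True False by (simp add: diam_power_def ennreal_le_1)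
      next
        case t0: False
        have "diameter (U j) powr s \<le> diameter (U j) powr t" using powr_mono'[OF t(2) d] .
        then show ?thesis using t0 False by (simp add: diam_power_def ennreal_leI)
      qed
    qed simp
    have "ennreal (1 / ?K) * 1 \<le> ennreal (1 / ?K) * (ennreal ?K * (\<Sum>j. ennreal (diameter (U j) powr s)))"
      by (intro mult_left_mono 1) simp
    also have "\<dots> = (\<Sum>j. ennreal (diameter (U j) powr s))"
    proof -
      have "ennreal (1 / ?K) * ennreal ?K = 1"
        using K0 by (subst ennreal_mult[symmetric]) auto
      then show ?thesis by (simp only: mult.assoc[symmetric]) simp
    qed
    also have "\<dots> \<le> (\<Sum>j. diam_power t (U j))"
      by (intro suminf_le le) auto
    finally show "ennreal (1 / ?K) \<le> (\<Sum>j. diam_power t (U j))" by simp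
  qed
  also have "\<dots> \<le> hausdorff_measure t A"
    unfolding hausdorff_measure_def using \<delta>(1) by (intro SUP_upper) simp
  finally have "ennreal (1 / ?K) \<le> hausdorff_measure t A" .
  moreover have "0 < ennreal (1 / ?K)" using K0 by simp
  ultimately show ?thesis by auto
qed

lemma hausdorff_dim_eq:
  assumes E: "countable E" "limit_set - E \<subseteq> A" "A \<subseteq> limit_set"
    and s: "0 < s" and K: "\<And>m. (1/2)^m \<le> K * L m powr s"
    and lim: "\<And>t. s < t \<Longrightarrow> (\<lambda>n. 2^n * L n powr t) \<longlonglongrightarrow> 0"
  shows "hausdorff_dim A = ereal s"
  unfolding hausdorff_dim_def
proof (rule antisym)
  show "ereal s \<le> Inf {ereal t | t. 0 \<le> t \<and> hausdorff_measure t A = 0}"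
  proof (rule Inf_greatest)
    fix x assume "x \<in> {ereal t | t. 0 \<le> t \<and> hausdorff_measure t A = 0}"
    then obtain t where t: "x = ereal t" "0 \<le> t" "hausdorff_measure t A = 0" by blast
    then have "\<not> t \<le> s" using hausdorff_measure_nonzeroI[OF E(1,2) s K t(2)] by blast
    then show "ereal s \<le> x" using t(1) by simp
  qed
  show "Inf {ereal t | t. 0 \<le> t \<and> hausdorff_measure t A = 0} \<le> ereal s"
  \<comment> \<open>The measure at \<open>s\<close> itself is nonzero, so the infimum is only
    approached from above.\<close>
  proof (rule ereal_le_epsilon2)
    fix e :: real assume "0 < e"
    then have "hausdorff_measure (s + e) A = 0"
      using s by (intro hausdorff_measure_0I lim E(3)) auto
    then have "ereal (s + e) \<in> {ereal t | t. 0 \<le> t \<and> hausdorff_measure t A = 0}"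
      using s \<open>0 < e\<close> by force
    then show "Inf {ereal t | t. 0 \<le> t \<and> hausdorff_measure t A = 0} \<le> ereal s + ereal e"
      unfolding plus_ereal.simps by (rule Inf_lower)
  qed
qed

end

section \<open>Trigonometry of isosceles caps\<close>

lemma triangular_capD:
  assumes "triangular_cap a b c \<theta>"
  shows "a \<noteq> b" "0 \<le> \<theta>" "\<theta> \<le> pi" "dist a b = 2 * cos \<theta> * dist a c" "dist c b = dist a c"
    "(norm (c - midpoint a b))\<^sup>2 = (dist a c)\<^sup>2 - (dist a b)\<^sup>2 / 4"
proof -
  have nc: "\<not> collinear {a, b, c}" and iso: "dist a c = dist b c"
    and \<theta>: "\<theta> = arccos (((b - a) \<bullet> (c - a)) / (norm (b - a) * norm (c - a)))"
    using assms by (auto simp: triangular_cap_def vec_angle_def)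
  show "a \<noteq> b" using nc by auto
  have "a \<noteq> c" using nc by (auto simp: insert_commute)
  show "dist c b = dist a c" using iso by (simp add: dist_commute)
  define u v where "u = b - a" and "v = c - a"
  \<comment> \<open>Equality of the legs, expanded, says that the projection of a leg to the base is
    half the base; the cosine formula follows.\<close>
  have "norm v = norm (u - v)" using iso by (simp add: u_def v_def dist_norm norm_minus_commute)
  then have "v \<bullet> v = (u - v) \<bullet> (u - v)" by (simp add: norm_eq)
  then have uv: "u \<bullet> v = (norm u)\<^sup>2 / 2"
    by (simp add: inner_diff_left inner_diff_right inner_commute power2_norm_eq_inner)
  have pos: "0 < norm u" "0 < norm v" using \<open>a \<noteq> b\<close> \<open>a \<noteq> c\<close> by (simp_all add: u_def v_def)
  have "\<bar>u \<bullet> v\<bar> \<le> norm u * norm v" by (rule Cauchy_Schwarz_ineq2)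
  then have "\<bar>(u \<bullet> v) / (norm u * norm v)\<bar> \<le> 1" using pos by (simp add: abs_mult)
  then have bds: "- 1 \<le> (u \<bullet> v) / (norm u * norm v)" "(u \<bullet> v) / (norm u * norm v) \<le> 1" by linarith+
  have \<theta>': "\<theta> = arccos ((u \<bullet> v) / (norm u * norm v))" by (simp add: \<theta> u_def v_def)
  show "0 \<le> \<theta>" "\<theta> \<le> pi" unfolding \<theta>' using bds by (simp_all add: arccos_lbound arccos_ubound)
  have "cos \<theta> = (u \<bullet> v) / (norm u * norm v)" unfolding \<theta>' using bds by (rule cos_arccos)
  also have "\<dots> = norm u / (2 * norm v)" using pos by (simp add: uv power2_eq_square)
  finally show "dist a b = 2 * cos \<theta> * dist a c"
    using pos by (simp add: u_def v_def dist_norm norm_minus_commute)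
  have m: "c - midpoint a b = v - (1/2) *\<^sub>R u"
    by (simp add: midpoint_conv_diff(1) u_def v_def)
  have "(norm (c - midpoint a b))\<^sup>2 = v \<bullet> v - u \<bullet> v + (u \<bullet> u) / 4"
    unfolding m power2_norm_eq_inner by (simp add: inner_diff_left inner_diff_right inner_commute)
  also have "\<dots> = (norm v)\<^sup>2 - (norm u)\<^sup>2 / 4"
    unfolding uv power2_norm_eq_inner by simp
  finally show "(norm (c - midpoint a b))\<^sup>2 = (dist a c)\<^sup>2 - (dist a b)\<^sup>2 / 4"
    by (simp add: u_def v_def dist_norm norm_minus_commute)
qed

text \<open>The squared height is the squared leg minus a quarter of the squared base, and the base
  is \<open>2 * cos \<theta>\<close> legs. In terms of the cosine the condition passes to smaller
  angles, hence from level 0 to all levels.\<close>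

lemma triangular_cap_flat_iff:
  assumes "triangular_cap a b c \<theta>"
  shows "flat_tri a b c \<longleftrightarrow> 1 \<le> (1 + 4 / 10000) * (cos \<theta>)\<^sup>2"
proof -
  note cap = triangular_capD[OF assms]
  have "0 < dist a c" using cap(1,5) by (metis dist_eq_0_iff dist_nz)
  have "flat_tri a b c \<longleftrightarrow> (norm (c - midpoint a b))\<^sup>2 \<le> (dist a b / 100)\<^sup>2"
    unfolding flat_tri_def by (rule power_mono_iff[symmetric]) auto
  also have "\<dots> \<longleftrightarrow> 1 * (dist a c)\<^sup>2 \<le> ((1 + 4 / 10000) * (cos \<theta>)\<^sup>2) * (dist a c)\<^sup>2"
    unfolding cap(6) unfolding cap(4) by (simp add: power_mult_distrib power_divide field_simps)
  also have "\<dots> \<longleftrightarrow> 1 \<le> (1 + 4 / 10000) * (cos \<theta>)\<^sup>2"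
    using \<open>0 < dist a c\<close> by (subst mult_le_cancel_right_pos) simp_all
  finally show ?thesis .
qed

text \<open>Equal legs make the vector from midpoint to apex orthogonal to the base, so by
  Pythagoras no point of the base line is nearer to the apex than the midpoint.\<close>

lemma norm_apex_le_cap_height:
  assumes "dist a c = dist b c"
  shows "norm (c - midpoint a b) \<le> cap_height a b c"
  unfolding cap_height_def
proof (subst infdist_notempty, simp, rule cINF_greatest)
  fix z assume "z \<in> affine hull {a, b}"
  then obtain u v where "z = u *\<^sub>R a + v *\<^sub>R b" "u + v = 1" by (auto simp: affine_hull_2)
  then have "z = (1 - v) *\<^sub>R a + v *\<^sub>R b" by (metis add_diff_cancel_right')
  then have z: "z = a + v *\<^sub>R (b - a)" by (simp add: scaleR_diff_left scaleR_diff_right)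
  define w where "w = c - midpoint a b"
  have "(norm (c - a))\<^sup>2 = (norm (c - b))\<^sup>2" using assms by (simp add: dist_norm norm_minus_commute)
  moreover have "c - a = w + (1/2) *\<^sub>R (b - a)" "c - b = w - (1/2) *\<^sub>R (b - a)"
    unfolding w_def by (simp add: midpoint_conv_diff(1), simp add: midpoint_conv_diff(2))
  ultimately have orth: "w \<bullet> (b - a) = 0"
    by (simp add: power2_norm_eq_inner inner_add_left inner_add_right inner_diff_left inner_diff_right inner_commute)
  have "c - z = w + (1/2 - v) *\<^sub>R (b - a)"
    by (simp add: z w_def midpoint_conv_diff(1) scaleR_diff_left)
  then have "(norm (c - z))\<^sup>2 = (norm w)\<^sup>2 + (norm ((1/2 - v) *\<^sub>R (b - a)))\<^sup>2"
    using orth by (simp add: norm_add_Pythagorean orthogonal_def)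
  then have "(norm w)\<^sup>2 \<le> (norm (c - z))\<^sup>2" by simp
  then show "norm (c - midpoint a b) \<le> dist c z" by (simp add: w_def dist_norm)
qed simp
section \<open>Cap systems\<close>

lemma cap_system_triangular_cap:
  "cap_system \<epsilon> \<theta> a b c \<Longrightarrow> i \<in> {1..2^n} \<Longrightarrow> triangular_cap (a n i) (b n i) (c n i) (\<theta> n)"
  unfolding cap_system_def by blast

text \<open>A closed segment determines its unordered pair of endpoints.\<close>

lemma cap_system_children:
  assumes "cap_system \<epsilon> \<theta> a b c" "i \<in> {1..2^n}"
  shows "{{a (Suc n) (2*i-1), b (Suc n) (2*i-1)}, {a (Suc n) (2*i), b (Suc n) (2*i)}} =
      {{a n i, c n i}, {c n i, b n i}}"
proof -
  have "{closed_segment (a (Suc n) (2*i-1)) (b (Suc n) (2*i-1)),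
         closed_segment (a (Suc n) (2*i)) (b (Suc n) (2*i))} =
        {closed_segment (a n i) (c n i), closed_segment (c n i) (b n i)}"
    using assms unfolding cap_system_def by blast
  then show ?thesis by (simp only: doubleton_eq_iff[of "closed_segment _ _"] closed_segment_eq doubleton_eq_iff[of "{_, _}"])
qed

text \<open>The height condition makes the cap of level 0 flat; as the angles decrease within
  \<open>[0, pi]\<close>, their cosines only grow, so the bounds hold at every level.\<close>

lemma cap_system_angles:
  assumes "cap_system \<epsilon> \<theta> a b c"
  shows "0 < \<theta> n" "\<theta> n \<le> pi" "decseq \<theta>" "1 \<le> (1 + 4 / 10000) * (cos (\<theta> n))\<^sup>2" "50 / 51 \<le> cos (\<theta> n)"
proof -
  let ?a = "a 0 1" and ?b = "b 0 1" and ?c = "c 0 1"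
  have pos: "0 < \<theta> n" for n using assms unfolding cap_system_def by blast
  then show "0 < \<theta> n" .
  show dec: "decseq \<theta>" using assms unfolding cap_system_def by (intro decseq_SucI) blast
  have cap: "triangular_cap ?a ?b ?c (\<theta> 0)" by (rule cap_system_triangular_cap[OF assms]) simp
  have \<epsilon>: "0 < \<epsilon>" "\<epsilon> < 1 / 100"
    and h: "ennreal (cap_height ?a ?b ?c) = ennreal \<epsilon> * hausdorff_measure 1 (closed_segment ?a ?b)"
    using assms unfolding cap_system_def by blast+
  have "ennreal (cap_height ?a ?b ?c) \<le> ennreal \<epsilon> * ennreal (dist ?a ?b)"
    unfolding h by (intro mult_left_mono hausdorff_measure_1_segment_le) simp
  also have "\<dots> = ennreal (\<epsilon> * dist ?a ?b)" using \<epsilon> by (simp add: ennreal_mult)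
  finally have "cap_height ?a ?b ?c \<le> \<epsilon> * dist ?a ?b" using \<epsilon> by (simp add: ennreal_le_iff)
  also have "\<dots> \<le> 1 / 100 * dist ?a ?b" using \<epsilon> by (intro mult_right_mono) auto
  finally have "norm (?c - midpoint ?a ?b) \<le> dist ?a ?b / 100"
    using norm_apex_le_cap_height[of ?a ?c ?b] triangular_capD(5)[OF cap] by (simp add: dist_commute)
  then have cos0: "1 \<le> (1 + 4 / 10000) * (cos (\<theta> 0))\<^sup>2"
    using triangular_cap_flat_iff[OF cap] by (simp add: flat_tri_def)
  \<comment> \<open>Flatness controls only the square of the cosine; its sign comes from the
    positive length of the base.\<close>
  have "0 < 2 * cos (\<theta> 0) * dist ?a ?c"
    using triangular_capD(1,4)[OF cap] by (metis zero_less_dist_iff)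
  then have cos0_pos: "0 < cos (\<theta> 0)" by (simp add: zero_less_mult_iff)
  have "\<theta> n \<le> \<theta> 0" using dec by (simp add: decseq_def)
  then show "\<theta> n \<le> pi" using triangular_capD(3)[OF cap] by simp
  have "cos (\<theta> 0) \<le> cos (\<theta> n)"
    using triangular_capD(3)[OF cap] pos[of n] \<open>\<theta> n \<le> \<theta> 0\<close> by (intro cos_monotone_0_pi_le) auto
  then have "(cos (\<theta> 0))\<^sup>2 \<le> (cos (\<theta> n))\<^sup>2" "0 < cos (\<theta> n)" using cos0_pos by (auto intro!: power_mono)
  then show cosn: "1 \<le> (1 + 4 / 10000) * (cos (\<theta> n))\<^sup>2" using cos0 by simp
  \<comment> \<open>Flatness gives a squared cosine of at least \<open>2500/2501\<close>, which
    exceeds \<open>(50/51)^2 = 2500/2601\<close>. The value \<open>50/51\<close> yields the ratio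
    \<open>51/100\<close> of \<open>flat_tree\<close>.\<close>
  show "50 / 51 \<le> cos (\<theta> n)"
  proof (rule power2_le_imp_le)
    show "(50 / 51)\<^sup>2 \<le> (cos (\<theta> n))\<^sup>2" using cosn by (simp add: power2_eq_square)
  qed (use \<open>0 < cos (\<theta> n)\<close> in simp)
qed

lemma cap_system_flat_tree:
  assumes sys: "cap_system \<epsilon> \<theta> a b c"
  defines "L \<equiv> (\<lambda>n. dist (a 0 1) (b 0 1) * (\<Prod>k<n. 1 / (2 * cos (\<theta> k))))"
  shows "flat_tree a b c L"
proof
  have cos_pos: "0 < cos (\<theta> n)" for n using cap_system_angles(5)[OF sys, of n] by simp
  have "a 0 1 \<noteq> b 0 1" using sys unfolding cap_system_def by blast
  then show L_pos: "0 < L n" for n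
    unfolding L_def using cos_pos by (intro mult_pos_pos prod_pos) auto
  have L_Suc: "L (Suc n) = L n / (2 * cos (\<theta> n))" for n by (simp add: L_def)
  show "L (Suc n) \<le> 51 / 100 * L n" for n
  proof -
    have "L n / (2 * cos (\<theta> n)) \<le> L n / (2 * (50 / 51))"
      using cap_system_angles(5)[OF sys, of n] L_pos[of n] by (intro divide_left_mono) auto
    then show ?thesis by (simp add: L_Suc)
  qed
  show flat: "flat_tri (a n i) (b n i) (c n i)" if "i \<in> {1..2^n}" for n i
    using triangular_cap_flat_iff[OF cap_system_triangular_cap[OF sys that]] cap_system_angles(4)[OF sys, of n] by simp
  show "{{a (Suc n) (2*i-1), b (Suc n) (2*i-1)}, {a (Suc n) (2*i), b (Suc n) (2*i)}} =
      {{a n i, c n i}, {c n i, b n i}}" if "i \<in> {1..2^n}" for n i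
    by (rule cap_system_children[OF sys that])
  show "convex hull {a (Suc n) k, b (Suc n) k, c (Suc n) k} \<subseteq> convex hull {a n i, b n i, c n i}"
    if "i \<in> {1..2^n}" "k \<in> {2*i-1, 2*i}" for n i k
    using sys that unfolding cap_system_def triangle_def by blast
  show "dist (a n i) (b n i) = L n" if "i \<in> {1..2^n}" for n i
    using that
  proof (induction n arbitrary: i)
    case 0
    then show ?case by (simp add: L_def)
  next
    case (Suc n)
    \<comment> \<open>The index of the parent of triangle \<open>i\<close>.\<close>
    define j where "j = (i + 1) div 2"
    have j: "j \<in> {1..2^n}" "i \<in> {2*j-1, 2*j}" using Suc.prems by (auto simp: j_def)
    note cap = triangular_capD[OF cap_system_triangular_cap[OF sys j(1)]]
    have "2 * cos (\<theta> n) * dist (a n j) (c n j) = L n" using Suc.IH[OF j(1)] cap(4) by simp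
    then have leg: "dist (a n j) (c n j) = L (Suc n)" using cos_pos[of n] by (simp add: L_Suc field_simps)
    have "{a (Suc n) i, b (Suc n) i} \<in> {{a n j, c n j}, {c n j, b n j}}"
      unfolding cap_system_children[OF sys j(1), symmetric] using j(2) by auto
    then show ?case using leg cap(5) by (auto simp: doubleton_eq_iff dist_commute)
  qed
qed

text \<open>The ratio test makes \<open>x\<close> summable. It is meant for
  \<open>2^n * L n powr t\<close>, whose successive ratios converge but are not constant.\<close>

lemma geometric_ratio_tendsto_0:
  fixes x :: "nat \<Rightarrow> real"
  assumes "\<And>n. x (Suc n) = q n * x n" "q \<longlonglongrightarrow> q'" "\<bar>q'\<bar> < 1"
  shows "x \<longlonglongrightarrow> 0"
proof -
  obtain C where C: "\<bar>q'\<bar> < C" "C < 1" using dense[OF assms(3)] by blast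
  have "(\<lambda>n. \<bar>q n\<bar>) \<longlonglongrightarrow> \<bar>q'\<bar>" by (intro tendsto_rabs assms)
  from order_tendstoD(2)[OF this C(1)] obtain N where N: "\<And>n. N \<le> n \<Longrightarrow> \<bar>q n\<bar> < C"
    by (auto simp: eventually_sequentially)
  have "norm (x (Suc n)) \<le> C * norm (x n)" if "N \<le> n" for n
    using N[OF that] by (auto simp: assms(1) abs_mult intro!: mult_right_mono)
  then have "summable x" using C(2) by (intro summable_ratio_test)
  then show ?thesis by (rule summable_LIMSEQ_zero)
qed

text \<open>Sandwiching \<open>A\<close> treats the limit set with and without its vertices at once.
  The ratios \<open>L (Suc n) / L n\<close> converge to \<open>\<rho>\<close> from above: the limit
  gives the upper bound, the one-sided inequality the lower bound.\<close>

lemma hausdorff_dim_cap_system: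
  assumes sys: "cap_system \<epsilon> \<theta> a b c" and lim: "\<theta> \<longlonglongrightarrow> r" and r: "0 \<le> r"
    and A: "cap_limit_set a b c - cap_vertices a b c \<subseteq> A" "A \<subseteq> cap_limit_set a b c"
  defines "\<rho> \<equiv> 1 / (2 * cos r)"
  shows "0 < cos r" "hausdorff_dim A = ereal (- (ln 2 / ln \<rho>))"
proof -
  define L where "L = (\<lambda>n. dist (a 0 1) (b 0 1) * (\<Prod>k<n. 1 / (2 * cos (\<theta> k))))"
  interpret flat_tree a b c L
    unfolding L_def by (rule cap_system_flat_tree[OF sys])
  note ang = cap_system_angles[OF sys]
  have cos_pos: "0 < cos (\<theta> n)" for n using ang(5)[of n] by simp
  have cos_lim: "(\<lambda>n. cos (\<theta> n)) \<longlonglongrightarrow> cos r" by (intro tendsto_cos lim)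
  have "50 / 51 \<le> cos r" by (rule LIMSEQ_le_const[OF cos_lim]) (use ang(5) in blast)
  then show cosr: "0 < cos r" by simp
  have \<rho>: "0 < \<rho>" "\<rho> < 1"
    using \<open>50 / 51 \<le> cos r\<close> by (simp_all add: \<rho>_def field_simps)
  have ratio_lim: "(\<lambda>n. 1 / (2 * cos (\<theta> n))) \<longlonglongrightarrow> \<rho>"
    unfolding \<rho>_def using cosr by (intro tendsto_intros cos_lim) auto
  have ratio_ge: "\<rho> \<le> 1 / (2 * cos (\<theta> n))" for n
  proof -
    have "r \<le> \<theta> n" by (rule decseq_ge[OF ang(3) lim])
    then have "cos (\<theta> n) \<le> cos r" using r ang(2)[of n] by (intro cos_monotone_0_pi_le) auto
    then show ?thesis unfolding \<rho>_def using cos_pos[of n] by (intro divide_left_mono) auto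
  qed
  define s where "s = - (ln 2 / ln \<rho>)"
  have ln_neg: "ln \<rho> < 0" using \<rho> by simp
  then have s: "0 < s" by (simp add: s_def divide_pos_neg)
  have \<rho>s: "\<rho> powr s = 1/2"
    using \<rho> ln_neg by (simp add: powr_def s_def exp_minus)
  have L_ge: "L 0 * \<rho>^n \<le> L n" for n
  proof (induction n)
    case (Suc n)
    have "L 0 * \<rho>^n * \<rho> \<le> L n * (1 / (2 * cos (\<theta> n)))"
      using Suc ratio_ge[of n] \<rho> L_pos[of n] by (intro mult_mono) auto
    also have "\<dots> = L (Suc n)" by (simp add: L_def)
    finally show ?case by (simp add: mult_ac)
  qed simp
  have "hausdorff_dim A = ereal s"
  proof (rule hausdorff_dim_eq[OF _ _ _ s])
    show "countable (cap_vertices a b c)" unfolding cap_vertices_def by auto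
    have eq: "limit_set = cap_limit_set a b c"
      by (simp add: limit_set_def cap_limit_set_def triangle_def)
    show "limit_set - cap_vertices a b c \<subseteq> A" "A \<subseteq> limit_set" using A unfolding eq by auto
    \<comment> \<open>Since \<open>(1/2)^m = (\<rho>^m) powr s\<close>, the bound
      \<open>L_ge\<close> raised to the power \<open>s\<close> gives this constant.\<close>
    show "(1/2)^m \<le> (1 / L 0 powr s) * L m powr s" for m
    proof -
      have "L 0 powr s * (1/2)^m = L 0 powr s * (\<rho>^m) powr s"
      proof -
        have "(1/2)^m = (\<rho> powr s)^m" by (simp add: \<rho>s)
        also have "\<dots> = (\<rho>^m) powr s" using \<rho> by (simp add: powr_power powr_realpow[symmetric] powr_powr mult.commute)
        finally show ?thesis by simp
      qed
      also have "\<dots> = (L 0 * \<rho>^m) powr s" using \<rho> L_pos[of 0] by (simp add: powr_mult)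
      also have "\<dots> \<le> L m powr s" using L_ge \<rho> L_pos[of 0] s by (intro powr_mono2) auto
      finally show ?thesis using L_pos[of 0] by (simp add: field_simps)
    qed
    fix t assume t: "s < t"
    show "(\<lambda>n. 2^n * L n powr t) \<longlonglongrightarrow> 0"
    proof (rule geometric_ratio_tendsto_0)
      show "2 ^ Suc n * L (Suc n) powr t = (2 * (1 / (2 * cos (\<theta> n))) powr t) * (2^n * L n powr t)" for n
      proof -
        have "L (Suc n) = L n * (1 / (2 * cos (\<theta> n)))" by (simp add: L_def)
        then have "L (Suc n) powr t = L n powr t * (1 / (2 * cos (\<theta> n))) powr t"
          using L_pos[of n] cos_pos[of n] by (simp only: powr_mult)
        then show ?thesis by simp
      qed
      show "(\<lambda>n. 2 * (1 / (2 * cos (\<theta> n))) powr t) \<longlonglongrightarrow> 2 * \<rho> powr t"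
        using \<rho> by (intro tendsto_intros ratio_lim) auto
      \<comment> \<open>Below base 1 a larger exponent gives a smaller power, so the limiting ratio
        drops below \<open>2 * (1/2) = 1\<close>.\<close>
      have "\<rho> powr t < \<rho> powr s" using t \<rho> by (intro powr_less_mono') auto
      then show "\<bar>2 * \<rho> powr t\<bar> < 1" by (simp add: \<rho>s)
    qed
  qed
  then show "hausdorff_dim A = ereal (- (ln 2 / ln \<rho>))" by (simp add: s_def)
qed

theorem theorem8p8:
  fixes r :: real and A :: "(real^2) set"
  assumes "0 \<le> r" and "A \<in> A_class r"
  shows "hausdorff_dim A = ereal (- (ln 2 / ln (1 / 2 * (1 + (tan r)\<^sup>2) powr (1 / 2))))"
proof -
  obtain \<theta> \<epsilon> a b c where sys: "cap_system \<epsilon> \<theta> a b c" and lim: "\<theta> \<longlonglongrightarrow> r"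
    and A: "A \<in> {cap_limit_set a b c, cap_limit_set a b c - cap_vertices a b c}"
    using assms(2) unfolding A_class_def A_eps_type_with_angles_def by blast
  have A': "cap_limit_set a b c - cap_vertices a b c \<subseteq> A" "A \<subseteq> cap_limit_set a b c" using A by auto
  note dim = hausdorff_dim_cap_system[OF sys lim assms(1) A']
  \<comment> \<open>By \<open>1 + tan^2 = 1/cos^2\<close> and \<open>0 < cos r\<close>, the argument
    of the logarithm is \<open>1 / (2 * cos r)\<close>.\<close>
  have "(1 + (tan r)\<^sup>2) powr (1/2) = sqrt ((inverse (cos r))\<^sup>2)"
    using dim(1) tan_sec[of r] by (simp add: powr_half_sqrt)
  also have "\<dots> = 1 / cos r" using dim(1) by (simp add: inverse_eq_divide)
  finally show ?thesis using dim(2) by simp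
qed

end
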